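(* Every rank one module in $\mathrm{CM}(A)$ is isomorphic to $L_I$ for some unique $k$-subset $I\subseteq\{1,\dots,n\}$.
   Context: Let $n\ge 2$ and $1\le k\le n-1$. Let $R$ be either $\mathbb{C}[x,y]/(x^k-y^{n-k})$ or $\mathbb{C}[[x,y]]/(x^k-y^{n-k})$ (the result is asserted in both cases). $G=\{\zeta\in\mathbb{C}^*:\zeta^n=1\}$ acts on $R$ by $(x,y)\mapsto(\zeta x,\zeta^{-1}y)$; $Z=R^G$ is $\mathbb{C}[t]$ or $\mathbb{C}[[t]]$ respectively, with $t=xy$; $A=R*G$ is the twisted group ring. Equivalently $A$ is the quotient of the path algebra (completed in the power series case) of the quiver with vertex set $\mathbb{Z}_n$ and arrows $x_a\colon(a-1)\to(a)$, $y_a\colon(a)\to(a-1)$, $a=1,\dots,n$, by the (closed) ideal generated by the relations $xy=yx$, $x^k=y^{n-k}$ at each vertex. Left $A$-modules are representations of this quiver; $e_j$ is the idempotent at vertex $j$ ($e_n=e_0$). $\mathrm{CM}(A)$ is the category of finitely generated left $A$-modules that are free over $Z$. The rank $\mathrm{rk}(M)$ is the length of $M\otimes_Z K$ over $A\otimes_Z K\cong M_n(K)$, $K=\mathrm{Frac}(Z)$; equivalently $\mathrm{rk}(M)=\mathrm{rk}_Z(e_jM)$ for any $j$. For a $k$-subset $I\subseteq\{1,\dots,n\}$, $L_I\in\mathrm{CM}(A)$ is the module with $e_iL_I=Z$ for all $i\in\mathbb{Z}_n$, where $x_a\colon Z\to Z$ is multiplication by $1$ if $a\in I$ and by $t$ if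 $a\notin I$, and $y_a\colon Z\to Z$ is multiplication by $t$ if $a\in I$ and by $1$ if $a\notin I$. *)

theory Defs
  imports
    "HOL-Algebra.Algebra"
    "HOL-Algebra.Algebraic_Closure_Type"
    "HOL-Computational_Algebra.Computational_Algebra"
    "HOL-Library.Extended_Nat"
begin

section \<open>Left modules, free modules, length after localisation\<close>

text \<open>The locale \<^locale>\<open>module\<close> of the library is for commutative rings only; here
  \<open>R\<close> may be noncommutative, and its ring axioms are not made part of the assumptions.  The
  records \<^typ>\<open>('a, 'm) module\<close> and the locale \<^locale>\<open>submodule\<close> are used as they stand; the ring
  fields \<open>mult\<close> and \<open>one\<close> of a module record play no role.\<close>

locale left_module = abelian_group M
  for R :: "('a, 'c) ring_scheme" (structure) and M :: "('a, 'm, 'd) module_scheme" (structure) +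
  assumes smult_closed:
      "\<lbrakk>a \<in> carrier R; m \<in> carrier M\<rbrakk> \<Longrightarrow> a \<odot>\<^bsub>M\<^esub> m \<in> carrier M"
    and smult_l_distr:
      "\<lbrakk>a \<in> carrier R; b \<in> carrier R; m \<in> carrier M\<rbrakk> \<Longrightarrow>
        (a \<oplus>\<^bsub>R\<^esub> b) \<odot>\<^bsub>M\<^esub> m = a \<odot>\<^bsub>M\<^esub> m \<oplus>\<^bsub>M\<^esub> b \<odot>\<^bsub>M\<^esub> m"
    and smult_r_distr:
      "\<lbrakk>a \<in> carrier R; m \<in> carrier M; m' \<in> carrier M\<rbrakk> \<Longrightarrow>
        a \<odot>\<^bsub>M\<^esub> (m \<oplus>\<^bsub>M\<^esub> m') = a \<odot>\<^bsub>M\<^esub> m \<oplus>\<^bsub>M\<^esub> a \<odot>\<^bsub>M\<^esub> m'"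
    and smult_assoc1:
      "\<lbrakk>a \<in> carrier R; b \<in> carrier R; m \<in> carrier M\<rbrakk> \<Longrightarrow>
        (a \<otimes>\<^bsub>R\<^esub> b) \<odot>\<^bsub>M\<^esub> m = a \<odot>\<^bsub>M\<^esub> (b \<odot>\<^bsub>M\<^esub> m)"
    and smult_one:
      "m \<in> carrier M \<Longrightarrow> \<one>\<^bsub>R\<^esub> \<odot>\<^bsub>M\<^esub> m = m"

definition finitely_generated_module ::
    "('a, 'c) ring_scheme \<Rightarrow> ('a, 'm, 'd) module_scheme \<Rightarrow> bool" where
  "finitely_generated_module R M \<longleftrightarrow>
    (\<exists>F. finite F \<and> F \<subseteq> carrier M \<and>
      (\<forall>N. submodule N R M \<and> F \<subseteq> N \<longrightarrow> N = carrier M))"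

definition free_module ::
    "('a, 'c) ring_scheme \<Rightarrow> ('a, 'm, 'd) module_scheme \<Rightarrow> bool" where
  "free_module R M \<longleftrightarrow>
    (\<exists>B \<subseteq> carrier M. \<forall>m \<in> carrier M. \<exists>!c. c \<in> B \<rightarrow>\<^sub>E carrier R \<and>
      finite {b \<in> B. c b \<noteq> \<zero>\<^bsub>R\<^esub>} \<and>
      m = (\<Oplus>\<^bsub>M\<^esub>b \<in> {b \<in> B. c b \<noteq> \<zero>\<^bsub>R\<^esub>}. c b \<odot>\<^bsub>M\<^esub> b))"

definition restrict_scalars ::
    "('z \<Rightarrow> 'a) \<Rightarrow> ('a, 'm, 'd) module_scheme \<Rightarrow> ('z, 'm) module" where
  "restrict_scalars f M =
    \<lparr>carrier = carrier M, monoid.mult = monoid.mult M, one = monoid.one M,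
     ring.zero = ring.zero M, ring.add = ring.add M,
     module.smult = (\<lambda>z m. f z \<odot>\<^bsub>M\<^esub> m)\<rparr>"

text \<open>For a commutative domain \<open>Z\<close> with fraction field \<open>K\<close> and a \<open>Z\<close>-module \<open>N\<close>, the tensor
  product of \<open>N\<close> with \<open>K\<close> is the module of fractions \<open>m/s\<close>, with \<open>m\<close> in \<open>N\<close> and \<open>s\<close> in
  \<open>Z - {0}\<close>.  A fraction is the set of all pairs that represent it.\<close>

definition nonzero :: "('z, 'c) ring_scheme \<Rightarrow> 'z set" where
  "nonzero Z = carrier Z - {\<zero>\<^bsub>Z\<^esub>}"

definition mfrac ::
    "('z, 'c) ring_scheme \<Rightarrow> ('z, 'm, 'd) module_scheme \<Rightarrow> 'm \<Rightarrow> 'z \<Rightarrow> ('m \<times> 'z) set" where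
  "mfrac Z N m s = {(m', s'). m' \<in> carrier N \<and> s' \<in> nonzero Z \<and>
    (\<exists>u \<in> nonzero Z. u \<odot>\<^bsub>N\<^esub> (s' \<odot>\<^bsub>N\<^esub> m) = u \<odot>\<^bsub>N\<^esub> (s \<odot>\<^bsub>N\<^esub> m'))}"

definition fractions ::
    "('z, 'c) ring_scheme \<Rightarrow> ('z, 'm, 'd) module_scheme \<Rightarrow> ('m \<times> 'z) set set" where
  "fractions Z N = {mfrac Z N m s | m s. m \<in> carrier N \<and> s \<in> nonzero Z}"

text \<open>Let \<open>A\<close> be an algebra over \<open>Z\<close> with structure map \<open>f\<close>, and \<open>M\<close> a left \<open>A\<close>-module.  Every
  element of the tensor product of \<open>A\<close> and \<open>K\<close> over \<open>Z\<close> is of the form \<open>a/s\<close>, and it acts on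
  fractions by \<open>(a/s)(m/s') = (a m)/(s s')\<close>; the submodules over that ring are the following.\<close>

definition frac_submodule ::
    "('z, 'c) ring_scheme \<Rightarrow> ('z \<Rightarrow> 'a) \<Rightarrow> ('a, 'e) ring_scheme \<Rightarrow> ('a, 'm, 'd) module_scheme \<Rightarrow>
     ('m \<times> 'z) set set \<Rightarrow> bool" where
  "frac_submodule Z f A M U \<longleftrightarrow>
    (let N = restrict_scalars f M in
      U \<subseteq> fractions Z N \<and> mfrac Z N \<zero>\<^bsub>M\<^esub> \<one>\<^bsub>Z\<^esub> \<in> U \<and>
      (\<forall>m \<in> carrier M. \<forall>s \<in> nonzero Z. \<forall>m' \<in> carrier M. \<forall>s' \<in> nonzero Z.
        mfrac Z N m s \<in> U \<and> mfrac Z N m' s' \<in> U \<longrightarrow>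
        mfrac Z N (s' \<odot>\<^bsub>N\<^esub> m \<oplus>\<^bsub>M\<^esub> s \<odot>\<^bsub>N\<^esub> m') (s \<otimes>\<^bsub>Z\<^esub> s') \<in> U) \<and>
      (\<forall>a \<in> carrier A. \<forall>s \<in> nonzero Z. \<forall>m \<in> carrier M. \<forall>s' \<in> nonzero Z.
        mfrac Z N m s' \<in> U \<longrightarrow> mfrac Z N (a \<odot>\<^bsub>M\<^esub> m) (s \<otimes>\<^bsub>Z\<^esub> s') \<in> U))"

definition frac_length ::
    "('z, 'c) ring_scheme \<Rightarrow> ('z \<Rightarrow> 'a) \<Rightarrow> ('a, 'e) ring_scheme \<Rightarrow> ('a, 'm, 'd) module_scheme \<Rightarrow>
     enat" where
  "frac_length Z f A M =
    (SUP l \<in> {l. \<exists>U. (\<forall>i\<le>l. frac_submodule Z f A M (U i)) \<and> (\<forall>i<l. U i \<subset> U (Suc i))}. enat l)"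


section \<open>Twisted group rings\<close>

text \<open>The function \<open>f\<close> stands for \<open>\<Sum>g. f g * g\<close>, with multiplication determined by
  \<open>(r * g) (s * h) = r (act g s) * (g h)\<close>.\<close>

definition twisted_group_ring ::
    "('r, 'c) ring_scheme \<Rightarrow> ('g, 'd) monoid_scheme \<Rightarrow> ('g \<Rightarrow> 'r \<Rightarrow> 'r) \<Rightarrow> ('g \<Rightarrow> 'r) ring" where
  "twisted_group_ring R G act =
    \<lparr>carrier = carrier G \<rightarrow>\<^sub>E carrier R,
     monoid.mult = (\<lambda>f f'. \<lambda>h \<in> carrier G.
       \<Oplus>\<^bsub>R\<^esub>g \<in> carrier G. f g \<otimes>\<^bsub>R\<^esub> act g (f' (inv\<^bsub>G\<^esub> g \<otimes>\<^bsub>G\<^esub> h))),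
     one = (\<lambda>h \<in> carrier G. if h = \<one>\<^bsub>G\<^esub> then \<one>\<^bsub>R\<^esub> else \<zero>\<^bsub>R\<^esub>),
     ring.zero = (\<lambda>h \<in> carrier G. \<zero>\<^bsub>R\<^esub>),
     ring.add = (\<lambda>f f'. \<lambda>h \<in> carrier G. f h \<oplus>\<^bsub>R\<^esub> f' h)\<rparr>"

definition twisted_scalar ::
    "('r, 'c) ring_scheme \<Rightarrow> ('g, 'd) monoid_scheme \<Rightarrow> 'r \<Rightarrow> 'g \<Rightarrow> 'r" where
  "twisted_scalar R G r = (\<lambda>h \<in> carrier G. if h = \<one>\<^bsub>G\<^esub> then r else \<zero>\<^bsub>R\<^esub>)"


section \<open>The algebra \<open>A\<close>\<close>

text \<open>The common interface of \<open>\<complex>[x,y]\<close> and \<open>\<complex>[[x,y]]\<close>; \<open>rot \<zeta>\<close> is the automorphism with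
  \<open>x \<mapsto> \<zeta> x\<close> and \<open>y \<mapsto> \<zeta>\<inverse> y\<close>.  Both rings are taken as univariate over univariate, with \<open>x\<close> the
  outer and \<open>y\<close> the inner variable.\<close>

record 's xy_ring =
  scal :: "complex \<Rightarrow> 's"
  xvar :: 's
  yvar :: 's
  rot :: "complex \<Rightarrow> 's \<Rightarrow> 's"

definition xy_poly :: "complex poly poly xy_ring" where
  "xy_poly =
    \<lparr>scal = (\<lambda>c. [:[:c:]:]),
     xvar = [:0, 1:],
     yvar = [:[:0, 1:]:],
     rot = (\<lambda>\<zeta> f. map_poly (\<lambda>p. p \<circ>\<^sub>p [:0, inverse \<zeta>:]) f \<circ>\<^sub>p [:0, [:\<zeta>:]:])\<rparr>"

definition xy_fps :: "complex fps fps xy_ring" where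
  "xy_fps =
    \<lparr>scal = (\<lambda>c. fps_const (fps_const c)),
     xvar = fps_X,
     yvar = fps_const fps_X,
     rot = (\<lambda>\<zeta> f. Abs_fps (\<lambda>a. Abs_fps (\<lambda>b. \<zeta> ^ a * inverse \<zeta> ^ b * fps_nth (fps_nth f a) b)))\<rparr>"

definition roots_group :: "nat \<Rightarrow> complex monoid" where
  "roots_group n = \<lparr>carrier = {\<zeta>. \<zeta> ^ n = 1}, monoid.mult = (*), one = 1\<rparr>"

definition rel_ideal :: "('s::comm_ring_1) xy_ring \<Rightarrow> nat \<Rightarrow> nat \<Rightarrow> 's set" where
  "rel_ideal S n k = PIdl\<^bsub>ring_of_type_algebra\<^esub> (xvar S ^ k - yvar S ^ (n - k))"

definition R_ring :: "('s::comm_ring_1) xy_ring \<Rightarrow> nat \<Rightarrow> nat \<Rightarrow> 's set ring" where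
  "R_ring S n k = ring_of_type_algebra Quot rel_ideal S n k"

definition cls :: "('s::comm_ring_1) xy_ring \<Rightarrow> nat \<Rightarrow> nat \<Rightarrow> 's \<Rightarrow> 's set" where
  "cls S n k s = rel_ideal S n k +>\<^bsub>ring_of_type_algebra\<^esub> s"

definition A_ring :: "('s::comm_ring_1) xy_ring \<Rightarrow> nat \<Rightarrow> nat \<Rightarrow> (complex \<Rightarrow> 's set) ring" where
  "A_ring S n k = twisted_group_ring (R_ring S n k) (roots_group n) (\<lambda>\<zeta> r. rot S \<zeta> ` r)"

abbreviation to_A :: "('s::comm_ring_1) xy_ring \<Rightarrow> nat \<Rightarrow> nat \<Rightarrow> 's set \<Rightarrow> complex \<Rightarrow> 's set" where
  "to_A S n k \<equiv> twisted_scalar (R_ring S n k) (roots_group n)"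

definition Z_ring :: "('s::comm_ring_1) xy_ring \<Rightarrow> nat \<Rightarrow> nat \<Rightarrow> 's set ring" where
  "Z_ring S n k = (R_ring S n k)
    \<lparr>carrier := {r \<in> carrier (R_ring S n k). \<forall>\<zeta> \<in> carrier (roots_group n). rot S \<zeta> ` r = r}\<rparr>"

definition t_elem :: "('s::comm_ring_1) xy_ring \<Rightarrow> nat \<Rightarrow> nat \<Rightarrow> 's set" where
  "t_elem S n k = cls S n k (xvar S * yvar S)"

text \<open>\<open>e\<^sub>j = (1/n) \<Sum>\<zeta>. \<zeta>\<^sup>-\<^sup>j \<zeta>\<close>, so that \<open>e\<^sub>j M\<close> is the part of \<open>M\<close> on which each
  \<open>\<zeta> \<in> G\<close> acts as \<open>\<zeta>\<^sup>j\<close>.  Since \<open>\<zeta> x = (\<zeta> x) \<zeta>\<close> in \<open>A\<close>, where the bracket is in \<open>R\<close>,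
  multiplication by \<open>x\<close> goes from \<open>e\<^sub>j M\<close> to \<open>e\<^sub>j\<^sub>+\<^sub>1 M\<close> and multiplication by \<open>y\<close> goes back.\<close>

definition idem :: "('s::comm_ring_1) xy_ring \<Rightarrow> nat \<Rightarrow> nat \<Rightarrow> nat \<Rightarrow> complex \<Rightarrow> 's set" where
  "idem S n k j = (\<lambda>\<zeta> \<in> carrier (roots_group n). cls S n k (scal S (inverse \<zeta> ^ j / of_nat n)))"


section \<open>Cohen-Macaulay modules and rank\<close>

definition CM :: "('s::comm_ring_1) xy_ring \<Rightarrow> nat \<Rightarrow> nat \<Rightarrow>
    (complex \<Rightarrow> 's set, 'm) module \<Rightarrow> bool" where
  "CM S n k M \<longleftrightarrow>
    left_module (A_ring S n k) M \<and>
    finitely_generated_module (A_ring S n k) M \<and>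
    free_module (Z_ring S n k) (restrict_scalars (to_A S n k) M)"

definition rk :: "('s::comm_ring_1) xy_ring \<Rightarrow> nat \<Rightarrow> nat \<Rightarrow>
    (complex \<Rightarrow> 's set, 'm) module \<Rightarrow> enat" where
  "rk S n k M = frac_length (Z_ring S n k) (to_A S n k) (A_ring S n k) M"


section \<open>Representations of the quiver and the modules \<open>L\<^sub>I\<close>\<close>

text \<open>A representation over \<open>Z\<close> of the quiver with vertices \<open>0, \<dots>, n - 1\<close> (the residues modulo
  \<open>n\<close>) and arrows \<open>x\<^sub>a : a - 1 \<rightarrow> a mod n\<close> and \<open>y\<^sub>a : a mod n \<rightarrow> a - 1\<close> for \<open>a = 1, \<dots>, n\<close>.\<close>

record ('z, 'm) quiver_rep =
  space :: "nat \<Rightarrow> ('z, 'm) module"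
  xmap :: "nat \<Rightarrow> 'm \<Rightarrow> 'm"
  ymap :: "nat \<Rightarrow> 'm \<Rightarrow> 'm"

definition rep_iso :: "('z, 'c) ring_scheme \<Rightarrow> nat \<Rightarrow>
    ('z, 'm) quiver_rep \<Rightarrow> ('z, 'm') quiver_rep \<Rightarrow> bool" where
  "rep_iso Z n V W \<longleftrightarrow> (\<exists>\<phi> :: nat \<Rightarrow> 'm \<Rightarrow> 'm'.
    (\<forall>j<n. bij_betw (\<phi> j) (carrier (space V j)) (carrier (space W j)) \<and>
      (\<forall>u \<in> carrier (space V j). \<forall>v \<in> carrier (space V j).
        \<phi> j (u \<oplus>\<^bsub>space V j\<^esub> v) = \<phi> j u \<oplus>\<^bsub>space W j\<^esub> \<phi> j v) \<and>
      (\<forall>z \<in> carrier Z. \<forall>v \<in> carrier (space V j).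
        \<phi> j (z \<odot>\<^bsub>space V j\<^esub> v) = z \<odot>\<^bsub>space W j\<^esub> \<phi> j v)) \<and>
    (\<forall>a \<in> {1..n}.
      (\<forall>v \<in> carrier (space V (a - 1)). \<phi> (a mod n) (xmap V a v) = xmap W a (\<phi> (a - 1) v)) \<and>
      (\<forall>v \<in> carrier (space V (a mod n)). \<phi> (a - 1) (ymap V a v) = ymap W a (\<phi> (a mod n) v))))"

definition module_rep :: "('s::comm_ring_1) xy_ring \<Rightarrow> nat \<Rightarrow> nat \<Rightarrow>
    (complex \<Rightarrow> 's set, 'm) module \<Rightarrow> ('s set, 'm) quiver_rep" where
  "module_rep S n k M =
    \<lparr>space = (\<lambda>j. (restrict_scalars (to_A S n k) M)
       \<lparr>carrier := (\<lambda>m. idem S n k j \<odot>\<^bsub>M\<^esub> m) ` carrier M\<rparr>),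
     xmap = (\<lambda>a m. to_A S n k (cls S n k (xvar S)) \<odot>\<^bsub>M\<^esub> m),
     ymap = (\<lambda>a m. to_A S n k (cls S n k (yvar S)) \<odot>\<^bsub>M\<^esub> m)\<rparr>"

definition regular_module :: "'z ring \<Rightarrow> ('z, 'z) module" where
  "regular_module Z =
    \<lparr>carrier = carrier Z, monoid.mult = monoid.mult Z, one = monoid.one Z,
     ring.zero = ring.zero Z, ring.add = ring.add Z, module.smult = monoid.mult Z\<rparr>"

definition L_rep :: "('s::comm_ring_1) xy_ring \<Rightarrow> nat \<Rightarrow> nat \<Rightarrow> nat set \<Rightarrow>
    ('s set, 's set) quiver_rep" where
  "L_rep S n k I =
    \<lparr>space = (\<lambda>j. regular_module (Z_ring S n k)),
     xmap = (\<lambda>a v. (if a \<in> I then \<one>\<^bsub>Z_ring S n k\<^esub> else t_elem S n k) \<otimes>\<^bsub>Z_ring S n k\<^esub> v),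
     ymap = (\<lambda>a v. (if a \<in> I then t_elem S n k else \<one>\<^bsub>Z_ring S n k\<^esub>) \<otimes>\<^bsub>Z_ring S n k\<^esub> v)\<rparr>"

text \<open>Left \<open>A\<close>-modules are identified with representations of the quiver, via
  \<^const>\<open>module_rep\<close>; \<open>L\<^sub>I\<close> is given as a representation.\<close>

definition iso_to_L :: "('s::comm_ring_1) xy_ring \<Rightarrow> nat \<Rightarrow> nat \<Rightarrow>
    (complex \<Rightarrow> 's set, 'm) module \<Rightarrow> nat set \<Rightarrow> bool" where
  "iso_to_L S n k M I \<longleftrightarrow> rep_iso (Z_ring S n k) n (module_rep S n k M) (L_rep S n k I)"

end

theory Submission
  imports Defs
begin

text \<open>Since \<open>x y = t\<close> is injective on a torsion-free module, the \<open>e\<^sub>j M\<close> are all nonzero.  For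
  \<open>0 \<noteq> v \<in> e\<^sub>j M\<close> the saturation of \<open>A v\<close> is all of \<open>M\<close>, because the length of \<open>M\<close> over the fraction
  field is \<open>1\<close>; applying \<open>e\<^sub>j\<close> shows that \<open>e\<^sub>j M\<close> has rank one over \<open>Z\<close>, and a \<open>Z\<close>-linear functional
  that does not vanish at \<open>v\<close> embeds it as an ideal of the principal ideal domain \<open>Z\<close>.  Choose
  generators \<open>v\<^sub>a\<close> of \<open>e\<^sub>a M\<close>.  As \<open>t\<close> is prime, one of \<open>x : e\<^sub>a\<^sub>-\<^sub>1 M \<rightarrow> e\<^sub>a M\<close> and \<open>y\<close> in the opposite
  direction is an isomorphism, and rescaling successively gives \<open>x v\<^sub>a\<^sub>-\<^sub>1 = v\<^sub>a\<close> (for \<open>a \<in> I\<close>) or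
  \<open>x v\<^sub>a\<^sub>-\<^sub>1 = t v\<^sub>a\<close>.  Going once around the quiver, \<open>x\<^sup>n = t\<^sup>n\<^sup>-\<^sup>k\<close> forces \<open>|I| = k\<close> and \<open>v\<^sub>n = v\<^sub>0\<close>.
  Finally \<open>I\<close> is determined by the \<open>a\<close> for which \<open>x\<close> maps \<open>e\<^sub>a\<^sub>-\<^sub>1 M\<close> onto \<open>e\<^sub>a M\<close>.\<close>

section \<open>Coefficients and invariants\<close>

lemma roots_group_simps [simp]:
  "\<zeta> \<in> carrier (roots_group n) \<longleftrightarrow> \<zeta> ^ n = 1"
  "\<one>\<^bsub>roots_group n\<^esub> = 1" "\<zeta> \<otimes>\<^bsub>roots_group n\<^esub> \<eta> = \<zeta> * \<eta>"
  by (auto simp: roots_group_def)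

lemma sum_root_of_unity_powers:
  fixes \<zeta> :: complex
  assumes "\<zeta> ^ n = 1"
  shows "(\<Sum>j<n. \<zeta> ^ j) = (if \<zeta> = 1 then of_nat n else 0)"
  using assms by (simp add: geometric_sum)

text \<open>Powers of the primitive root \<open>w\<close> parametrise the roots, so the sum becomes
  a geometric sum in \<open>u = w ^ a * inverse w ^ b\<close>, itself an \<open>n\<close>-th root of
  unity.\<close>

lemma sum_over_roots_of_unity:
  assumes "0 < n"
  shows "(\<Sum>\<zeta> | \<zeta> ^ n = (1::complex). \<zeta> ^ a * inverse \<zeta> ^ b) = (if a mod n = b mod n then of_nat n else 0)"
proof -
  define w where "w = cis (2 * pi / real n)"
  have w0: "w \<noteq> 0" by (simp add: w_def)
  have wn: "w ^ n = 1" using assms by (simp add: w_def DeMoivre)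
  have cw: "cis (2 * pi * real j / real n) = w ^ j" for j
    by (simp add: w_def DeMoivre mult.commute)
  have bij: "bij_betw (\<lambda>j. w ^ j) {..<n} {\<zeta>. \<zeta> ^ n = 1}"
    using bij_betw_roots_unity[OF assms] by (simp add: cw)
  define u where "u = w ^ a * inverse w ^ b"
  have wmod: "w ^ c = w ^ (c mod n)" for c
  proof -
    have "w ^ c = w ^ (n * (c div n) + c mod n)" by simp
    also have "\<dots> = w ^ (c mod n)" by (simp only: power_add power_mult wn) simp
    finally show ?thesis .
  qed
  have u1: "u = 1 \<longleftrightarrow> a mod n = b mod n"
  proof -
    have "u = 1 \<longleftrightarrow> w ^ a = w ^ b" using w0 by (simp add: u_def field_simps)
    also have "\<dots> \<longleftrightarrow> w ^ (a mod n) = w ^ (b mod n)" using wmod by metis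
    also have "\<dots> \<longleftrightarrow> a mod n = b mod n"
      using inj_onD[OF bij_betw_imp_inj_on[OF bij], of "a mod n" "b mod n"] assms by auto
    finally show ?thesis .
  qed
  have un: "u ^ n = 1"
    by (simp add: u_def power_mult_distrib power_inverse)
      (metis (no_types) wn mult.commute power_mult power_one inverse_1 mult_1)
  have "(\<Sum>\<zeta> | \<zeta> ^ n = (1::complex). \<zeta> ^ a * inverse \<zeta> ^ b) = (\<Sum>j<n. (w ^ j) ^ a * inverse (w ^ j) ^ b)"
    using sum.reindex_bij_betw[OF bij, of "\<lambda>\<zeta>. \<zeta> ^ a * inverse \<zeta> ^ b"] by simp
  also have "\<dots> = (\<Sum>j<n. u ^ j)"
    by (intro sum.cong refl)
      (simp add: u_def power_mult_distrib power_inverse flip: power_mult, simp add: mult.commute)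
  finally show ?thesis
    using sum_root_of_unity_powers[OF un] u1 by simp
qed

text \<open>Both versions of the ring are treated at once, through the coefficients: \<open>cf s a b\<close> is the
  coefficient of \<open>x\<^sup>a y\<^sup>b\<close>, and \<open>ct f a\<close> that of \<open>t\<^sup>a\<close> in \<open>\<complex>[t]\<close> or \<open>\<complex>[[t]]\<close>.  The flag \<open>bdd\<close>
  distinguishes polynomials from power series.\<close>

locale xy_coeffs =
  fixes S :: "'s::comm_ring_1 xy_ring"
    and cf :: "'s \<Rightarrow> nat \<Rightarrow> nat \<Rightarrow> complex"
    and ct :: "'t::euclidean_ring \<Rightarrow> nat \<Rightarrow> complex"
    and bdd :: bool
    and n k :: nat
  assumes k_pos: "0 < k" and k_less: "k < n"
    and cf_inject: "(\<And>a b. cf s a b = cf s' a b) \<Longrightarrow> s = s'"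
    and cf_add: "cf (s + s') a b = cf s a b + cf s' a b"
    and cf_mult: "cf (s * s') a b = (\<Sum>i\<le>a. \<Sum>j\<le>b. cf s i j * cf s' (a - i) (b - j))"
    and cf_scal: "cf (scal S c) a b = (if a = 0 \<and> b = 0 then c else 0)"
    and cf_one: "cf 1 a b = (if a = 0 \<and> b = 0 then 1 else 0)"
    and cf_xvar: "cf (xvar S) a b = (if a = 1 \<and> b = 0 then 1 else 0)"
    and cf_yvar: "cf (yvar S) a b = (if a = 0 \<and> b = 1 then 1 else 0)"
    and cf_rot: "cf (rot S \<zeta> s) a b = \<zeta> ^ a * inverse \<zeta> ^ b * cf s a b"
    and cf_bounded: "bdd \<Longrightarrow> \<exists>D. \<forall>a b. cf s a b \<noteq> 0 \<longrightarrow> a \<le> D \<and> b \<le> D"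
    and cf_ex: "(bdd \<Longrightarrow> \<exists>D. \<forall>a b. e a b \<noteq> 0 \<longrightarrow> a \<le> D \<and> b \<le> D) \<Longrightarrow> \<exists>s. \<forall>a b. cf s a b = e a b"
    and ct_inject: "(\<And>a. ct f a = ct f' a) \<Longrightarrow> f = f'"
    and ct_add: "ct (f + f') a = ct f a + ct f' a"
    and ct_mult: "ct (f * f') a = (\<Sum>i\<le>a. ct f i * ct f' (a - i))"
    and ct_one: "ct 1 a = (if a = 0 then 1 else 0)"
    and ct_bounded: "bdd \<Longrightarrow> \<exists>D. \<forall>a. ct f a \<noteq> 0 \<longrightarrow> a \<le> D"
    and ct_ex: "(bdd \<Longrightarrow> \<exists>D. \<forall>a. d a \<noteq> 0 \<longrightarrow> a \<le> D) \<Longrightarrow> \<exists>f. \<forall>a. ct f a = d a"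
begin

section \<open>Coefficients of sums, monomials and scalars\<close>

lemma n_pos: "0 < n" using k_less by simp

lemma cf_0 [simp]: "cf 0 a b = 0"
  using cf_add[of 0 0 a b] by simp

lemma cf_diff: "cf (s - s') a b = cf s a b - cf s' a b"
  using cf_add[of "s - s'" s' a b] by simp

lemma cf_sum: "cf (sum g F) a b = (\<Sum>i\<in>F. cf (g i) a b)"
  by (induction F rule: infinite_finite_induct) (auto simp: cf_add)

lemma ct_0 [simp]: "ct 0 a = 0"
  using ct_add[of 0 0 a] by simp

text \<open>Only the term with \<open>i = p\<close> and \<open>j = q\<close> of the Cauchy product
  survives, so a monomial acts by shifting the array of coefficients.\<close>

lemma cf_monom_mult:
  assumes "\<And>a b. cf m a b = (if a = p \<and> b = q then c else 0)"
  shows "cf (m * s) a b = (if p \<le> a \<and> q \<le> b then c * cf s (a - p) (b - q) else 0)"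
proof -
  have "(\<Sum>j\<le>b. cf m i j * cf s (a - i) (b - j)) =
      (if i = p \<and> q \<le> b then c * cf s (a - p) (b - q) else 0)" for i
  proof -
    have "(\<Sum>j\<le>b. cf m i j * cf s (a - i) (b - j)) =
        (\<Sum>j\<le>b. if j = q then (if i = p then c * cf s (a - p) (b - q) else 0) else 0)"
      by (intro sum.cong) (auto simp: assms)
    then show ?thesis by simp
  qed
  then have "cf (m * s) a b = (\<Sum>i\<le>a. if i = p then (if q \<le> b then c * cf s (a - p) (b - q) else 0) else 0)"
    unfolding cf_mult by (intro sum.cong) auto
  then show ?thesis by simp
qed

lemma cf_scal_mult: "cf (scal S c * s) a b = c * cf s a b"
  using cf_monom_mult[of "scal S c" 0 0 c] by (simp add: cf_scal)

lemma cf_xvar_power: "cf (xvar S ^ p) a b = (if a = p \<and> b = 0 then 1 else 0)"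
proof (induction p arbitrary: a b)
  case 0
  show ?case by (simp add: cf_one)
next
  case (Suc p)
  have "cf (xvar S * xvar S ^ p) a b = (if 1 \<le> a \<and> 0 \<le> b then 1 * cf (xvar S ^ p) (a - 1) (b - 0) else 0)"
    by (rule cf_monom_mult) (simp add: cf_xvar)
  then show ?case by (auto simp: Suc)
qed

lemma cf_yvar_power: "cf (yvar S ^ p) a b = (if a = 0 \<and> b = p then 1 else 0)"
proof (induction p arbitrary: a b)
  case 0
  show ?case by (simp add: cf_one)
next
  case (Suc p)
  have "cf (yvar S * yvar S ^ p) a b = (if 0 \<le> a \<and> 1 \<le> b then 1 * cf (yvar S ^ p) (a - 0) (b - 1) else 0)"
    by (rule cf_monom_mult) (simp add: cf_yvar)
  then show ?case by (auto simp: Suc)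
qed

lemma scal_1: "scal S 1 = 1"
  by (rule cf_inject) (simp add: cf_scal cf_one)

lemma scal_mult: "scal S (c * d) = scal S c * scal S d"
  by (rule cf_inject) (simp add: cf_scal cf_scal_mult)

lemma scal_0: "scal S 0 = 0"
  by (rule cf_inject) (simp add: cf_scal)

lemma scal_add: "scal S (c + d) = scal S c + scal S d"
  by (rule cf_inject) (simp add: cf_scal cf_add)

section \<open>Divisibility by the relation \<open>x^k - y^(n-k)\<close>\<close>

definition rel :: 's where "rel = xvar S ^ k - yvar S ^ (n - k)"

lemma rel_ideal_iff: "s \<in> rel_ideal S n k \<longleftrightarrow> rel dvd s"
  unfolding rel_ideal_def cgenideal_def ring_of_type_algebra_def rel_def
  by (auto simp: dvd_def mult.commute)

lemma cf_rel_mult: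
  "cf (rel * q) a b = (if k \<le> a then cf q (a - k) b else 0) - (if n - k \<le> b then cf q a (b - (n - k)) else 0)"
  unfolding rel_def left_diff_distrib cf_diff
  by (simp add: cf_monom_mult[OF cf_xvar_power] cf_monom_mult[OF cf_yvar_power])

text \<open>Modulo \<open>rel\<close>, \<open>x^k\<close> may be traded for \<open>y^(n-k)\<close>,
  so all monomials on such a line are congruent to \<open>x^p y^b\<close>. For
  \<open>b < n - k\<close> the value is therefore the coefficient of \<open>x^p y^b\<close> in the
  normal form of \<open>s\<close> of degree below \<open>n - k\<close> in \<open>y\<close>. The
  bound \<open>p div k\<close> keeps the natural subtraction exact.\<close>

definition line_sum :: "'s \<Rightarrow> nat \<Rightarrow> nat \<Rightarrow> complex" where
  "line_sum s p b = (\<Sum>i\<le>p div k. cf s (p - i * k) (b + i * (n - k)))"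

lemma line_sum_diff: "line_sum (s - s') p b = line_sum s p b - line_sum s' p b"
  by (simp add: line_sum_def cf_diff sum_subtractf)

text \<open>Along a line the two shifted copies of \<open>q\<close> telescope;
  \<open>b < n - k\<close> ensures that the line has no earlier point.\<close>

lemma line_sum_rel_mult:
  assumes "b < n - k"
  shows "line_sum (rel * q) p b = 0"
proof -
  define N where "N = p div k"
  \<comment> \<open>\<open>h i\<close> is the coefficient of \<open>q\<close> shared by the points
    \<open>i - 1\<close> (through \<open>x^k\<close>) and \<open>i\<close> (through
    \<open>y^(n-k)\<close>). The zeros at \<open>0\<close> and beyond \<open>N\<close> are the two
    ends of the telescope.\<close>
  define h where "h i = (if i = 0 \<or> N < i then 0 else cf q (p - i * k) (b + (i - 1) * (n - k)))" for i
  have "cf (rel * q) (p - i * k) (b + i * (n - k)) = h (Suc i) - h i" if "i \<le> N" for i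
  proof -
    have ik: "i * k \<le> p"
      using that k_pos by (simp add: N_def less_eq_div_iff_mult_less_eq)
    have "k \<le> p - i * k \<longleftrightarrow> Suc i * k \<le> p" using ik by auto
    also have "\<dots> \<longleftrightarrow> Suc i \<le> N" using k_pos by (simp add: N_def less_eq_div_iff_mult_less_eq)
    finally have 1: "k \<le> p - i * k \<longleftrightarrow> Suc i \<le> N" .
    have 2: "n - k \<le> b + i * (n - k) \<longleftrightarrow> i \<noteq> 0" using assms by (cases i) auto
    have 3: "b + i * (n - k) - (n - k) = b + (i - 1) * (n - k)" if "i \<noteq> 0"
      using that by (cases i) auto
    show ?thesis
      unfolding cf_rel_mult 1 2 using that 3 by (auto simp: h_def add.commute)
  qed
  then have "line_sum (rel * q) p b = (\<Sum>i\<le>N. h (Suc i) - h i)"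
    by (simp add: line_sum_def flip: N_def)
  also have "\<dots> = 0"
    using sum_lessThan_telescope[of h "Suc N"] by (simp add: h_def lessThan_Suc_atMost del: sum.lessThan_Suc)
  finally show ?thesis .
qed

text \<open>For the converse, comparing coefficients in \<open>rel * q = s\<close> along each line
  leaves a single candidate for \<open>q\<close>: minus the sum of the coefficients of
  \<open>s\<close> from the next point on.\<close>

lemma rel_dvd_iff: "rel dvd s \<longleftrightarrow> (\<forall>p b. b < n - k \<longrightarrow> line_sum s p b = 0)"
proof
  assume "rel dvd s"
  then show "\<forall>p b. b < n - k \<longrightarrow> line_sum s p b = 0"
    by (auto simp: line_sum_rel_mult elim!: dvdE)
next
  assume L: "\<forall>p b. b < n - k \<longrightarrow> line_sum s p b = 0"
  define q0 where "q0 p b = - line_sum s p (b + (n - k))" for p b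
  have q0_eq: "q0 p b = - (\<Sum>i\<le>p div k. cf s (p - i * k) (b + Suc i * (n - k)))" for p b
    by (simp add: q0_def line_sum_def add.assoc)
  have shift: "(if k \<le> p then q0 (p - k) b else 0) = cf s p b - line_sum s p b" for p b
  proof (cases "k \<le> p")
    case True
    then have N: "p div k = Suc ((p - k) div k)"
      using k_pos by (simp add: le_div_geq)
    show ?thesis
      using True by (simp add: q0_eq line_sum_def N sum.atMost_Suc_shift del: sum.atMost_Suc)
  next
    case False
    then show ?thesis by (simp add: line_sum_def)
  qed
  \<comment> \<open>At \<open>b < n - k\<close> the left side is \<open>0\<close>; this is where the
    vanishing of the line sums enters.\<close>
  have shift': "(if n - k \<le> b then q0 p (b - (n - k)) else 0) = - line_sum s p b" for p b
    using L by (auto simp: q0_def)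
  have "\<exists>q. \<forall>a b. cf q a b = q0 a b"
  proof (rule cf_ex)
    assume bdd
    then obtain D where D: "\<forall>a b. cf s a b \<noteq> 0 \<longrightarrow> a \<le> D \<and> b \<le> D"
      using cf_bounded by blast
    \<comment> \<open>A nonzero value stems from a nonzero coefficient of \<open>s\<close> on the
      line. The number \<open>i\<close> of steps is at most \<open>D\<close>, because each step
      raises the exponent of \<open>y\<close> by at least one, and this bounds
      \<open>p\<close>.\<close>
    have "p \<le> D + k * D \<and> b \<le> D + k * D" if "q0 p b \<noteq> 0" for p b
    proof -
      from that obtain i where "cf s (p - i * k) (b + Suc i * (n - k)) \<noteq> 0"
        unfolding q0_eq by (metis (no_types, lifting) neg_equal_0_iff_equal sum.neutral)
      then have i: "p - i * k \<le> D" "b + Suc i * (n - k) \<le> D" using D by blast+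
      have "Suc i \<le> Suc i * (n - k)" using k_less by (simp del: mult_Suc)
      then have "i \<le> D" using i(2) by linarith
      then have "i * k \<le> k * D" by (simp add: mult.commute)
      then show ?thesis using i by linarith
    qed
    then show "\<exists>D. \<forall>a b. q0 a b \<noteq> 0 \<longrightarrow> a \<le> D \<and> b \<le> D" by blast
  qed
  then obtain q where q: "\<And>a b. cf q a b = q0 a b" by blast
  have "rel * q = s"
    by (rule cf_inject) (simp only: cf_rel_mult q shift shift', simp)
  then show "rel dvd s" by (metis dvd_triv_left)
qed

section \<open>The subring of series in \<open>t = x y\<close>\<close>

lemma diag_ex: "\<exists>s. \<forall>a b. cf s a b = (if a = b then ct f a else 0)"
  by (rule cf_ex) (use ct_bounded[of f] in \<open>metis (full_types)\<close>)

text \<open>Substitution of \<open>x y\<close> for \<open>t\<close>. Only coefficients are available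
  here, so the element is picked by them; \<open>cf_inject\<close> makes the choice unique.\<close>

definition diag :: "'t \<Rightarrow> 's" where
  "diag f = (SOME s. \<forall>a b. cf s a b = (if a = b then ct f a else 0))"

lemma cf_diag: "cf (diag f) a b = (if a = b then ct f a else 0)"
  using someI_ex[OF diag_ex[of f]] by (simp add: diag_def)

lemma diag_add: "diag (f + g) = diag f + diag g"
  by (rule cf_inject) (simp add: cf_diag cf_add ct_add)

lemma diag_0: "diag 0 = 0"
  by (rule cf_inject) (simp add: cf_diag)

lemma diag_1: "diag 1 = 1"
  by (rule cf_inject) (simp add: cf_diag cf_one ct_one)

lemma diag_mult: "diag (f * g) = diag f * diag g"
proof (rule cf_inject)
  fix a b
  have "cf (diag f * diag g) a b =
      (\<Sum>i\<le>a. \<Sum>j\<le>b. if j = i then (if a - i = b - i then ct f i * ct g (a - i) else 0) else 0)"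
    unfolding cf_mult by (intro sum.cong refl) (auto simp: cf_diag)
  also have "\<dots> = (\<Sum>i\<le>a. if i \<le> b \<and> a - i = b - i then ct f i * ct g (a - i) else 0)"
    by (intro sum.cong) auto
  also have "\<dots> = cf (diag (f * g)) a b"
    by (auto simp: cf_diag ct_mult intro!: sum.cong sum.neutral)
  finally show "cf (diag (f * g)) a b = cf (diag f * diag g) a b" by simp
qed

section \<open>The prime \<open>t\<close>\<close>

definition tvar :: 't where "tvar = (SOME f. \<forall>a. ct f a = (if a = 1 then 1 else 0))"

lemma ct_tvar: "ct tvar a = (if a = 1 then 1 else 0)"
proof -
  have "\<exists>f. \<forall>a. ct f a = (if a = 1 then 1 else 0)"
    by (rule ct_ex) auto
  from someI_ex[OF this] show ?thesis by (simp add: tvar_def)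
qed

lemma diag_tvar: "diag tvar = xvar S * yvar S"
  by (rule cf_inject)
    (auto simp: cf_diag ct_tvar cf_yvar cf_monom_mult[of "xvar S" 1 0 1, OF cf_xvar])

lemma tvar_neq_0: "tvar \<noteq> 0"
  using ct_tvar[of 1] by auto

lemma ct_mult_0: "ct (f * g) 0 = ct f 0 * ct g 0"
  by (simp add: ct_mult)

lemma unit_ct: "f * g = 1 \<Longrightarrow> ct f 0 \<noteq> 0"
  using ct_mult_0[of f g] by (auto simp: ct_one)

lemma tvar_not_unit: "tvar * g \<noteq> 1"
  using unit_ct[of tvar g] ct_tvar[of 0] by auto

lemma ct_tvar_mult: "ct (tvar * f) a = (if a = 0 then 0 else ct f (a - 1))"
proof -
  have "ct (tvar * f) a = (\<Sum>i\<le>a. if i = 1 then ct f (a - 1) else 0)"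
    unfolding ct_mult by (intro sum.cong) (auto simp: ct_tvar)
  then show ?thesis by simp
qed

lemma tvar_dvd:
  assumes "ct f 0 = 0"
  obtains g where "f = tvar * g"
proof -
  have "\<exists>g. \<forall>a. ct g a = ct f (Suc a)"
  proof (rule ct_ex)
    assume bdd
    then obtain D where "\<forall>a. ct f a \<noteq> 0 \<longrightarrow> a \<le> D" using ct_bounded by blast
    then have "\<forall>a. ct f (Suc a) \<noteq> 0 \<longrightarrow> a \<le> D" by (meson Suc_leD)
    then show "\<exists>D. \<forall>a. ct f (Suc a) \<noteq> 0 \<longrightarrow> a \<le> D" by blast
  qed
  then obtain g where g: "\<And>a. ct g a = ct f (Suc a)" by blast
  have "f = tvar * g"
    by (rule ct_inject) (use assms in \<open>auto simp: ct_tvar_mult g\<close>)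
  then show thesis by (rule that)
qed

text \<open>The constant coefficient is multiplicative, so it vanishes for one factor. That factor
  is a multiple of \<open>tvar\<close>, and cancelling \<open>tvar\<close> leaves an inverse of the
  other one.\<close>

lemma tvar_eq_mult:
  assumes "f * g = tvar"
  shows "(\<exists>u. f * u = 1) \<or> (\<exists>u. g * u = 1)"
proof -
  have "ct f 0 * ct g 0 = 0" using assms ct_mult_0[of f g] ct_tvar[of 0] by simp
  then consider "ct f 0 = 0" | "ct g 0 = 0" by auto
  then show ?thesis
  proof cases
    case 1
    then obtain f' where "f = tvar * f'" using tvar_dvd by blast
    then have "tvar * (g * f') = tvar * 1" using assms by (simp add: ac_simps)
    then show ?thesis using tvar_neq_0 by (metis mult_left_cancel)
  next
    case 2
    then obtain f' where "g = tvar * f'" using tvar_dvd by blast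
    then have "tvar * (f * f') = tvar * 1" using assms by (simp add: ac_simps)
    then show ?thesis using tvar_neq_0 by (metis mult_left_cancel)
  qed
qed

text \<open>If the exponents differed, cancelling the smaller power would make \<open>tvar\<close> a
  unit. This serves to close the circuit around the quiver, where it gives both the size of
  \<open>I\<close> and the equality of the first and last generators.\<close>

lemma tvar_power_unit_eq:
  assumes "tvar ^ a * u = tvar ^ b" "u * v = 1"
  shows "a = b \<and> u = 1"
proof -
  have cancel: "p = r" if "tvar ^ c * p = tvar ^ c * r" for c p r
    using that tvar_neq_0 by (metis mult_left_cancel power_not_zero)
  have "a = b"
  proof (rule ccontr)
    assume "a \<noteq> b"
    then consider d where "b = a + Suc d" | d where "a = b + Suc d"
      by (metis less_imp_Suc_add linorder_neqE_nat add_Suc_right)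
    then show False
    proof cases
      case 1
      then have "tvar ^ a * u = tvar ^ a * (tvar * tvar ^ d)"
        using assms(1) by (simp add: power_add)
      from cancel[OF this] have "tvar * (tvar ^ d * v) = 1" using assms(2) by (simp add: mult.assoc)
      then show False using tvar_not_unit by blast
    next
      case 2
      then have "tvar ^ b * (tvar * (tvar ^ d * u)) = tvar ^ b * 1"
        using assms(1) by (simp add: power_add ac_simps)
      from cancel[OF this] show False using tvar_not_unit by blast
    qed
  qed
  moreover from this have "u = 1" using assms(1) tvar_neq_0 by simp
  ultimately show ?thesis by simp
qed

section \<open>Invariants modulo the relation\<close>

text \<open>The \<open>i\<close>-th point of the line is diagonal exactly if
  \<open>p = b + i * n\<close>. As \<open>b < n\<close>, this has a solution precisely when the
  residues agree, namely \<open>i = p div n\<close>.\<close>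

lemma line_sum_diag:
  assumes "b < n - k"
  shows "line_sum (diag f) p b =
    (if p mod n = b mod n then ct f (b + (p - b) div n * (n - k)) else 0)"
proof (cases "p mod n = b mod n")
  case True
  have bn: "b < n" using assms by simp
  define i0 where "i0 = p div n"
  have p: "p = b + i0 * n"
    using True bn by (metis i0_def add.commute div_mult_mod_eq mod_less)
  have i0: "(p - b) div n = i0" using p n_pos by simp
  have i0k: "i0 * k \<le> i0 * n" using k_less by simp
  have "i0 \<le> p div k"
    using trans_le_add2[OF i0k, of b] k_pos p by (simp only: less_eq_div_iff_mult_less_eq)
  have on_diag: "(p - i * k = b + i * (n - k)) \<longleftrightarrow> i = i0" if "i \<le> p div k" for i
  proof -
    have ik: "i * k \<le> p"
      using that k_pos by (simp add: less_eq_div_iff_mult_less_eq)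
    have "p - i * k = b + i * (n - k) \<longleftrightarrow> p = b + (i * (n - k) + i * k)" using ik by auto
    also have "i * (n - k) + i * k = i * n" using k_less by (simp flip: add_mult_distrib2)
    finally show ?thesis using p n_pos by auto
  qed
  have "line_sum (diag f) p b = (\<Sum>i\<le>p div k. if i = i0 then ct f (b + i0 * (n - k)) else 0)"
    unfolding line_sum_def cf_diag
  proof (intro sum.cong refl)
    fix i assume "i \<in> {..p div k}"
    then show "(if p - i * k = b + i * (n - k) then ct f (p - i * k) else 0) =
        (if i = i0 then ct f (b + i0 * (n - k)) else 0)"
      using on_diag[of i] by (cases "i = i0") auto
  qed
  then show ?thesis using True \<open>i0 \<le> p div k\<close> i0 by simp
next
  case False
  have "p - i * k \<noteq> b + i * (n - k)" if "i \<le> p div k" for i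
  proof
    assume eq: "p - i * k = b + i * (n - k)"
    have "i * k \<le> p"
      using that k_pos by (simp add: less_eq_div_iff_mult_less_eq)
    then have "p = b + (i * (n - k) + i * k)" using eq by simp
    also have "i * (n - k) + i * k = i * n" using k_less by (simp flip: add_mult_distrib2)
    finally show False using False by simp
  qed
  then show ?thesis using False by (simp add: line_sum_def cf_diag)
qed

text \<open>Each diagonal point \<open>(a, a)\<close> lies on a line of its own, so vanishing line
  sums kill every coefficient of \<open>f\<close>. Consequently series in \<open>t\<close> embed
  into \<open>R\<close>.\<close>

lemma diag_rel_dvd_imp:
  assumes "rel dvd diag f"
  shows "f = 0"
proof (rule ct_inject)
  fix a
  \<comment> \<open>Going back \<open>i\<close> steps from \<open>(a, a)\<close> leads to the start
    \<open>(b + i * n, b)\<close> of its line.\<close>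
  define b i where "b = a mod (n - k)" and "i = a div (n - k)"
  have b: "b < n - k" using k_less by (simp add: b_def)
  have "line_sum (diag f) (b + i * n) b = ct f (b + i * (n - k))"
    using n_pos by (subst line_sum_diag[OF b]) simp
  moreover have "b + i * (n - k) = a" unfolding b_def i_def by (rule mod_div_mult_eq)
  ultimately show "ct f a = ct 0 a" using assms b by (simp add: rel_dvd_iff)
qed

text \<open>Modulo \<open>x\<^sup>k = y\<^sup>n\<^sup>-\<^sup>k\<close>, a \<open>G\<close>-invariant series is a series in \<open>t = x y\<close>: each line of
  exponents \<open>(p - i k, b + i (n - k))\<close> with \<open>p = b\<close> modulo \<open>n\<close> meets the diagonal, exactly once.\<close>

lemma invariant_cong_diag:
  assumes "\<And>a b. cf s a b \<noteq> 0 \<Longrightarrow> a mod n = b mod n"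
  obtains f where "rel dvd s - diag f"
proof -
  \<comment> \<open>The coefficient of \<open>t^a\<close> has to be the whole sum of
    \<open>s\<close> along the line through \<open>(a, a)\<close>, written with its starting
    point.\<close>
  define d where "d a = line_sum s (a mod (n - k) + a div (n - k) * n) (a mod (n - k))" for a
  have "\<exists>f. \<forall>a. ct f a = d a"
  proof (rule ct_ex)
    assume bdd
    then obtain D where D: "\<forall>a b. cf s a b \<noteq> 0 \<longrightarrow> a \<le> D \<and> b \<le> D"
      using cf_bounded by blast
    have "a \<le> D + k * D + D * n" if "d a \<noteq> 0" for a
    proof -
      define b i where "b = a mod (n - k)" and "i = a div (n - k)"
      from that obtain j where "cf s (b + i * n - j * k) (b + j * (n - k)) \<noteq> 0"
        unfolding d_def b_def i_def line_sum_def by (metis (no_types, lifting) sum.neutral)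
      then have j: "b + i * n - j * k \<le> D" "b + j * (n - k) \<le> D" using D by blast+
      have "j \<le> j * (n - k)" using k_less by (simp add: Suc_le_eq)
      then have "j \<le> D" using j(2) by linarith
      then have "j * k \<le> k * D" by (simp add: mult.commute)
      moreover have "i * (n - k) \<le> i * n" by simp
      moreover have "a = b + i * (n - k)" unfolding b_def i_def by (rule mod_div_mult_eq [symmetric])
      ultimately show ?thesis using j by linarith
    qed
    then show "\<exists>D. \<forall>a. d a \<noteq> 0 \<longrightarrow> a \<le> D" by blast
  qed
  then obtain f where f: "\<And>a. ct f a = d a" by blast
  have "line_sum (s - diag f) p b = 0" if b: "b < n - k" for p b
  proof (cases "p mod n = b mod n")
    case True
    have bn: "b < n" using b by simp
    define i0 where "i0 = p div n"
    have p: "p = b + i0 * n"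
      using True bn by (metis i0_def add.commute div_mult_mod_eq mod_less)
    have "(p - b) div n = i0" using p n_pos by simp
    then have "line_sum (diag f) p b = d (b + i0 * (n - k))"
      using True by (simp add: line_sum_diag[OF b] f)
    also have "\<dots> = line_sum s p b"
      using b p by (simp add: d_def)
    finally show ?thesis by (simp add: line_sum_diff)
  next
    case False
    \<comment> \<open>The difference of the two exponents changes by \<open>n\<close> at each step,
      so no point of this line has congruent exponents.\<close>
    have "cf s (p - i * k) (b + i * (n - k)) = 0" if "i \<le> p div k" for i
    proof (rule ccontr)
      assume "cf s (p - i * k) (b + i * (n - k)) \<noteq> 0"
      then have "(p - i * k) mod n = (b + i * (n - k)) mod n" by (rule assms)
      then have "(p - i * k + i * k) mod n = (b + i * (n - k) + i * k) mod n"
        by (rule mod_add_cong) simp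
      moreover have "i * k \<le> p"
        using that k_pos by (simp add: less_eq_div_iff_mult_less_eq)
      moreover have "b + i * (n - k) + i * k = b + i * n"
        using k_less by (simp add: add.assoc flip: add_mult_distrib2)
      ultimately show False using False by simp
    qed
    then have "line_sum s p b = 0" by (simp add: line_sum_def)
    then show ?thesis using False by (simp add: line_sum_diff line_sum_diag[OF b])
  qed
  then show thesis using that rel_dvd_iff by blast
qed

section \<open>The group action and averaging\<close>

lemma rot_diff: "rot S \<zeta> (s - s') = rot S \<zeta> s - rot S \<zeta> s'"
  by (rule cf_inject) (simp add: cf_rot cf_diff algebra_simps)

lemma rot_0: "rot S \<zeta> 0 = 0"
  by (rule cf_inject) (simp add: cf_rot)

lemma rot_mult: "rot S \<zeta> (s * s') = rot S \<zeta> s * rot S \<zeta> s'"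
proof (rule cf_inject)
  fix a b
  have "\<zeta> ^ a * inverse \<zeta> ^ b * (cf s i j * cf s' (a - i) (b - j)) =
      cf (rot S \<zeta> s) i j * cf (rot S \<zeta> s') (a - i) (b - j)" if "i \<le> a" "j \<le> b" for i j
  proof -
    have "\<zeta> ^ a = \<zeta> ^ i * \<zeta> ^ (a - i)" "inverse \<zeta> ^ b = inverse \<zeta> ^ j * inverse \<zeta> ^ (b - j)"
      using that by (simp_all flip: power_add)
    then show ?thesis by (simp add: cf_rot)
  qed
  then show "cf (rot S \<zeta> (s * s')) a b = cf (rot S \<zeta> s * rot S \<zeta> s') a b"
    by (simp add: cf_mult cf_rot[of \<zeta> "s * s'"] sum_distrib_left)
qed

lemma rot_scal: "rot S \<zeta> (scal S c) = scal S c"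
  by (rule cf_inject) (simp add: cf_rot cf_scal)

lemma rot_1: "rot S \<zeta> 1 = 1"
  using rot_scal[of \<zeta> 1] by (simp add: scal_1)

lemma rot_power: "rot S \<zeta> (s ^ m) = rot S \<zeta> s ^ m"
  by (induction m) (simp_all add: rot_1 rot_mult)

lemma rot_one_id: "rot S 1 s = s"
  by (rule cf_inject) (simp add: cf_rot)

lemma rot_rot: "rot S \<zeta> (rot S \<eta> s) = rot S (\<zeta> * \<eta>) s"
  by (rule cf_inject) (simp add: cf_rot power_mult_distrib)

lemma rot_xvar: "rot S \<zeta> (xvar S) = scal S \<zeta> * xvar S"
  by (rule cf_inject) (simp add: cf_rot cf_scal_mult cf_xvar)

lemma rot_yvar: "rot S \<zeta> (yvar S) = scal S (inverse \<zeta>) * yvar S"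
  by (rule cf_inject) (simp add: cf_rot cf_scal_mult cf_yvar)

lemma rot_diag: "\<zeta> \<noteq> 0 \<Longrightarrow> rot S \<zeta> (diag f) = diag f"
  by (rule cf_inject) (simp add: cf_rot cf_diag power_inverse)

lemma scal_power: "scal S (c ^ m) = scal S c ^ m"
  by (induction m) (simp_all add: scal_1 scal_mult)

lemma root_nonzero: "\<zeta> ^ n = 1 \<Longrightarrow> \<zeta> \<noteq> (0::complex)"
  using n_pos by (auto simp: zero_power)

text \<open>The condition \<open>\<zeta> ^ n = 1\<close> gives \<open>x^k\<close> and
  \<open>y^(n-k)\<close> the same weight. Hence the ideal of \<open>rel\<close> is stable and the
  group acts on \<open>R\<close>.\<close>

lemma rot_rel:
  assumes "\<zeta> ^ n = 1"
  shows "rot S \<zeta> rel = scal S (\<zeta> ^ k) * rel"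
proof -
  have "\<zeta> ^ (n - k) * \<zeta> ^ k = 1"
    using assms k_less by (simp flip: power_add)
  then have "inverse \<zeta> ^ (n - k) = \<zeta> ^ k"
    by (simp add: power_inverse inverse_unique)
  then show ?thesis
    by (simp add: rel_def rot_diff rot_power rot_xvar rot_yvar power_mult_distrib right_diff_distrib
        flip: scal_power)
qed

lemma rel_dvd_rot:
  assumes "\<zeta> ^ n = 1" "rel dvd s"
  shows "rel dvd rot S \<zeta> s"
  using assms by (auto simp: rot_mult rot_rel elim!: dvdE)

text \<open>The Reynolds operator of the group \<open>G\<close>.\<close>

definition avg :: "'s \<Rightarrow> 's" where
  "avg s = (\<Sum>\<zeta> | \<zeta> ^ n = 1. scal S (1 / of_nat n) * rot S \<zeta> s)"

lemma cf_avg: "cf (avg s) a b = (if a mod n = b mod n then cf s a b else 0)"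
proof -
  have "cf (avg s) a b = 1 / of_nat n * (\<Sum>\<zeta> | \<zeta> ^ n = 1. \<zeta> ^ a * inverse \<zeta> ^ b) * cf s a b"
    unfolding avg_def cf_sum cf_scal_mult cf_rot sum_distrib_left sum_distrib_right
    by (simp only: mult.assoc)
  then show ?thesis using n_pos by (simp add: sum_over_roots_of_unity)
qed

lemma avg_cong_diag:
  obtains f where "rel dvd avg s - diag f"
  using invariant_cong_diag[of "avg s"] by (metis cf_avg)

lemma finite_roots: "finite {\<zeta>::complex. \<zeta> ^ n = 1}"
  using n_pos by (simp add: finite_roots_unity)

text \<open>Here \<open>s\<close> is invariant only modulo \<open>rel\<close>. Its average is
  strictly invariant and lies in the same class, since each \<open>rot S \<zeta> s - s\<close> is a
  multiple of \<open>rel\<close>.\<close>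

lemma rot_invariant_cong_diag:
  assumes "\<And>\<zeta>. \<zeta> ^ n = 1 \<Longrightarrow> rel dvd rot S \<zeta> s - s"
  obtains f where "rel dvd s - diag f"
proof -
  have "avg s - s = (\<Sum>\<zeta> | \<zeta> ^ n = 1. scal S (1 / of_nat n) * (rot S \<zeta> s - s))"
  proof -
    have "(\<Sum>\<zeta> | \<zeta> ^ n = (1::complex). scal S (1 / of_nat n) * s) = s"
      unfolding sum_constant card_roots_unity_eq[OF n_pos]
    proof (rule cf_inject)
      fix a b
      have "cf (of_nat m * s') a b = of_nat m * cf s' a b" for m s'
        by (induction m) (simp_all add: cf_add algebra_simps)
      then show "cf (of_nat n * (scal S (1 / of_nat n) * s)) a b = cf s a b"
        using n_pos by (simp add: cf_scal_mult)
    qed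
    then show ?thesis by (simp add: avg_def right_diff_distrib sum_subtractf)
  qed
  then have 1: "rel dvd avg s - s" using assms by (auto intro!: dvd_sum)
  obtain f where 2: "rel dvd avg s - diag f" by (rule avg_cong_diag)
  have "rel dvd s - diag f" using dvd_diff[OF 2 1] by simp
  then show thesis by (rule that)
qed

end

section \<open>The algebra \<open>A\<close> and its modules\<close>

context xy_coeffs
begin

section \<open>The quotient ring \<open>R\<close> and its cosets\<close>

lemma ideal_rel: "ideal (rel_ideal S n k) ring_of_type_algebra"
  unfolding rel_ideal_def
  by (rule cring.cgenideal_ideal[OF cring_from_type_algebra]) (simp add: ring_of_type_algebra_def)

lemma cls_eq: "cls S n k s = {u. rel dvd u - s}"
proof -
  have "u \<in> cls S n k s \<longleftrightarrow> (\<exists>h. rel dvd h \<and> u = h + s)" for u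
    by (auto simp: cls_def a_r_coset_def' rel_ideal_iff ring_of_type_algebra_def)
  also have "\<dots> u \<longleftrightarrow> rel dvd u - s" for u
    by (metis add_diff_cancel_right' diff_add_cancel)
  finally show ?thesis by blast
qed

lemma cls_eq_iff: "cls S n k s = cls S n k s' \<longleftrightarrow> rel dvd s - s'"
proof
  assume "cls S n k s = cls S n k s'"
  moreover have "s \<in> cls S n k s" by (simp add: cls_eq)
  ultimately show "rel dvd s - s'" by (simp add: cls_eq)
next
  assume d: "rel dvd s - s'"
  have "rel dvd u - s \<longleftrightarrow> rel dvd u - s'" for u
    using dvd_add[OF _ d, of "u - s"] dvd_diff[OF _ d, of "u - s'"] by auto
  then show "cls S n k s = cls S n k s'" by (simp add: cls_eq)
qed

lemma R_carrier: "carrier (R_ring S n k) = range (cls S n k)"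
  by (auto simp: R_ring_def FactRing_def A_RCOSETS_def' cls_def ring_of_type_algebra_def)

lemma R_ops:
  "cls S n k s \<oplus>\<^bsub>R_ring S n k\<^esub> cls S n k s' = cls S n k (s + s')"
  "cls S n k s \<otimes>\<^bsub>R_ring S n k\<^esub> cls S n k s' = cls S n k (s * s')"
  "\<zero>\<^bsub>R_ring S n k\<^esub> = cls S n k 0"
  "\<one>\<^bsub>R_ring S n k\<^esub> = cls S n k 1"
proof -
  interpret ideal "rel_ideal S n k" "ring_of_type_algebra :: 's ring" by (rule ideal_rel)
  have car: "a \<in> carrier (ring_of_type_algebra :: 's ring)" for a
    by (simp add: ring_of_type_algebra_def)
  have ops: "a \<oplus>\<^bsub>ring_of_type_algebra\<^esub> b = a + b" "a \<otimes>\<^bsub>ring_of_type_algebra\<^esub> b = a * b"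
      "\<one>\<^bsub>ring_of_type_algebra\<^esub> = (1::'s)" for a b :: 's
    by (simp_all add: ring_of_type_algebra_def)
  show "cls S n k s \<oplus>\<^bsub>R_ring S n k\<^esub> cls S n k s' = cls S n k (s + s')"
    using a_rcos_sum[OF car car, of s s'] by (simp add: R_ring_def FactRing_def cls_def ops)
  show "cls S n k s \<otimes>\<^bsub>R_ring S n k\<^esub> cls S n k s' = cls S n k (s * s')"
    using rcoset_mult_add[OF car car, of s s'] by (simp add: R_ring_def FactRing_def cls_def ops)
  show "\<zero>\<^bsub>R_ring S n k\<^esub> = cls S n k 0"
    by (auto simp: R_ring_def FactRing_def cls_eq rel_ideal_iff)
  show "\<one>\<^bsub>R_ring S n k\<^esub> = cls S n k 1"
    by (simp add: R_ring_def FactRing_def cls_def ops)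
qed

lemma R_is_ring: "ring (R_ring S n k)"
  unfolding R_ring_def by (rule ideal.quotient_is_ring[OF ideal_rel])

lemma finsum_cls:
  "finite F \<Longrightarrow> finsum (R_ring S n k) (\<lambda>g. cls S n k (p g)) F = cls S n k (sum p F)"
proof (induction F rule: finite_induct)
  case empty
  then show ?case using R_is_ring by (simp add: R_ops abelian_monoid.finsum_empty abelian_group.axioms ring.is_abelian_group)
next
  case (insert g F)
  have "abelian_monoid (R_ring S n k)"
    using R_is_ring by (simp add: abelian_group.axioms ring.is_abelian_group)
  then show ?case
    using insert by (subst abelian_monoid.finsum_insert) (auto simp: R_carrier R_ops)
qed

text \<open>That the image fills the whole coset comes from rotation by
  \<open>inverse \<zeta>\<close>, which preserves the relation as well.\<close>

lemma rot_cls: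
  assumes "\<zeta> ^ n = 1"
  shows "rot S \<zeta> ` cls S n k s = cls S n k (rot S \<zeta> s)"
proof -
  have z: "inverse \<zeta> ^ n = 1" "\<zeta> \<noteq> 0" using assms root_nonzero[OF assms] by (simp_all add: power_inverse)
  show ?thesis
  proof (intro equalityI subsetI)
    fix u assume "u \<in> rot S \<zeta> ` cls S n k s"
    then obtain v where "u = rot S \<zeta> v" "rel dvd v - s" by (auto simp: cls_eq)
    then show "u \<in> cls S n k (rot S \<zeta> s)"
      using rel_dvd_rot[OF assms, of "v - s"] by (simp add: cls_eq rot_diff)
  next
    fix u assume "u \<in> cls S n k (rot S \<zeta> s)"
    then have "rel dvd rot S (inverse \<zeta>) (u - rot S \<zeta> s)"
      by (intro rel_dvd_rot z) (simp add: cls_eq)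
    then have "rot S (inverse \<zeta>) u \<in> cls S n k s"
      using z by (simp add: cls_eq rot_diff rot_rot rot_one_id)
    moreover have "u = rot S \<zeta> (rot S (inverse \<zeta>) u)"
      using z by (simp add: rot_rot rot_one_id)
    ultimately show "u \<in> rot S \<zeta> ` cls S n k s" by blast
  qed
qed

lemma inv_roots_group:
  assumes "\<zeta> ^ n = 1"
  shows "inv\<^bsub>roots_group n\<^esub> \<zeta> = inverse \<zeta>"
  unfolding m_inv_def
proof (rule the_equality)
  show "inverse \<zeta> \<in> carrier (roots_group n) \<and> \<zeta> \<otimes>\<^bsub>roots_group n\<^esub> inverse \<zeta> = \<one>\<^bsub>roots_group n\<^esub> \<and>
      inverse \<zeta> \<otimes>\<^bsub>roots_group n\<^esub> \<zeta> = \<one>\<^bsub>roots_group n\<^esub>"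
    using assms root_nonzero[OF assms] by (simp add: power_inverse)
qed (auto simp: inverse_unique)

section \<open>The twisted group ring \<open>A\<close>\<close>

text \<open>The sum of the \<open>p \<zeta>\<close> times \<open>\<zeta>\<close>, with coefficients
  given by representatives, so that calculations in \<open>A\<close> take place in the two-variable
  ring and not with cosets.\<close>

definition elt :: "(complex \<Rightarrow> 's) \<Rightarrow> complex \<Rightarrow> 's set" where
  "elt p = (\<lambda>\<zeta>\<in>carrier (roots_group n). cls S n k (p \<zeta>))"

abbreviation single :: "complex \<Rightarrow> 's \<Rightarrow> complex \<Rightarrow> 's set" where
  "single \<zeta> s \<equiv> elt (\<lambda>h. if h = \<zeta> then s else 0)"

lemma elt_cong: "(\<And>\<zeta>. \<zeta> ^ n = 1 \<Longrightarrow> p \<zeta> = q \<zeta>) \<Longrightarrow> elt p = elt q"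
  unfolding elt_def by (rule restrict_ext) simp

lemma A_carrier: "carrier (A_ring S n k) = range elt"
proof (intro equalityI subsetI)
  fix a assume a: "a \<in> carrier (A_ring S n k)"
  then have "\<forall>\<zeta>\<in>carrier (roots_group n). \<exists>s. a \<zeta> = cls S n k s"
    by (auto simp: A_ring_def twisted_group_ring_def R_carrier)
  then obtain p where p: "\<And>\<zeta>. \<zeta> \<in> carrier (roots_group n) \<Longrightarrow> a \<zeta> = cls S n k (p \<zeta>)" by metis
  have "a = elt p"
    unfolding elt_def using a p
    by (intro PiE_ext[where k = "carrier (roots_group n)" and s = "\<lambda>_. carrier (R_ring S n k)"])
      (auto simp: A_ring_def twisted_group_ring_def R_carrier)
  then show "a \<in> range elt" by blast
qed (auto simp: elt_def A_ring_def twisted_group_ring_def R_carrier)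

lemma elt_closed: "elt p \<in> carrier (A_ring S n k)"
  by (simp add: A_carrier)

lemma A_add: "elt p \<oplus>\<^bsub>A_ring S n k\<^esub> elt q = elt (\<lambda>\<zeta>. p \<zeta> + q \<zeta>)"
  by (simp add: elt_def A_ring_def twisted_group_ring_def R_ops cong: restrict_cong)

lemma A_one: "\<one>\<^bsub>A_ring S n k\<^esub> = single 1 1"
  by (simp add: elt_def A_ring_def twisted_group_ring_def R_ops if_distrib[of "cls S n k"] cong: if_cong)

lemma A_mult:
  "elt p \<otimes>\<^bsub>A_ring S n k\<^esub> elt q =
    elt (\<lambda>h. \<Sum>g | g ^ n = 1. p g * rot S g (q (inverse g * h)))"
proof -
  have "(\<Oplus>\<^bsub>R_ring S n k\<^esub>g\<in>carrier (roots_group n).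
      elt p g \<otimes>\<^bsub>R_ring S n k\<^esub> rot S g ` elt q (inv\<^bsub>roots_group n\<^esub> g \<otimes>\<^bsub>roots_group n\<^esub> h)) =
      cls S n k (\<Sum>g | g ^ n = 1. p g * rot S g (q (inverse g * h)))" if h: "h ^ n = 1" for h
  proof -
    have ab: "abelian_monoid (R_ring S n k)"
      using R_is_ring by (simp add: abelian_group.axioms ring.is_abelian_group)
    have "(\<Oplus>\<^bsub>R_ring S n k\<^esub>g\<in>carrier (roots_group n).
      elt p g \<otimes>\<^bsub>R_ring S n k\<^esub> rot S g ` elt q (inv\<^bsub>roots_group n\<^esub> g \<otimes>\<^bsub>roots_group n\<^esub> h)) =
      (\<Oplus>\<^bsub>R_ring S n k\<^esub>g\<in>{g. g ^ n = 1}. cls S n k (p g * rot S g (q (inverse g * h))))"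
    proof (rule abelian_monoid.finsum_cong'[OF ab])
      fix g assume "g \<in> {g::complex. g ^ n = 1}"
      then show "elt p g \<otimes>\<^bsub>R_ring S n k\<^esub> rot S g ` elt q (inv\<^bsub>roots_group n\<^esub> g \<otimes>\<^bsub>roots_group n\<^esub> h) =
          cls S n k (p g * rot S g (q (inverse g * h)))"
        using h by (simp add: elt_def inv_roots_group power_mult_distrib power_inverse rot_cls R_ops)
    qed (auto simp: R_carrier roots_group_def)
    then show ?thesis by (simp add: finsum_cls finite_roots)
  qed
  then show ?thesis
    by (simp add: A_ring_def twisted_group_ring_def elt_def[of "\<lambda>h. \<Sum>g | g ^ n = 1. p g * rot S g (q (inverse g * h))"]
        cong: restrict_cong)
qed

lemma A_single_mult:
  assumes "\<zeta> ^ n = 1"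
  shows "single \<zeta> s \<otimes>\<^bsub>A_ring S n k\<^esub> elt q = elt (\<lambda>h. s * rot S \<zeta> (q (inverse \<zeta> * h)))"
proof -
  have "(\<Sum>g | g ^ n = 1. (if g = \<zeta> then s else 0) * rot S g (q (inverse g * h))) =
      (\<Sum>g | g ^ n = 1. if g = \<zeta> then s * rot S \<zeta> (q (inverse \<zeta> * h)) else 0)" for h
    by (intro sum.cong) auto
  then show ?thesis using assms by (simp add: A_mult finite_roots)
qed

lemma A_single_mult_single:
  assumes "\<zeta> ^ n = 1"
  shows "single \<zeta> s \<otimes>\<^bsub>A_ring S n k\<^esub> single \<eta> s' = single (\<zeta> * \<eta>) (s * rot S \<zeta> s')"
  unfolding A_single_mult[OF assms]
  by (rule elt_cong) (use root_nonzero[OF assms] in \<open>auto simp: rot_0 field_simps\<close>)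

lemma to_A_cls: "to_A S n k (cls S n k s) = single 1 s"
  by (simp add: twisted_scalar_def elt_def R_ops if_distrib[of "cls S n k"] cong: if_cong)

lemma idem_elt: "idem S n k j = elt (\<lambda>\<zeta>. scal S (inverse \<zeta> ^ j / of_nat n))"
  by (simp add: idem_def elt_def)

section \<open>The invariant ring \<open>Z\<close>\<close>

text \<open>The isomorphism from \<open>\<complex>[t]\<close> or \<open>\<complex>[[t]]\<close> onto
  \<open>Z\<close>; through it \<open>Z\<close> inherits division with remainder.\<close>

definition zof :: "'t \<Rightarrow> 's set" where "zof f = cls S n k (diag f)"

lemma Z_ops:
  "zof f \<oplus>\<^bsub>Z_ring S n k\<^esub> zof g = zof (f + g)"
  "zof f \<otimes>\<^bsub>Z_ring S n k\<^esub> zof g = zof (f * g)"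
  "\<zero>\<^bsub>Z_ring S n k\<^esub> = zof 0"
  "\<one>\<^bsub>Z_ring S n k\<^esub> = zof 1"
  by (simp_all add: Z_ring_def zof_def R_ops diag_add diag_mult diag_0 diag_1)

lemma t_elem_zof: "t_elem S n k = zof tvar"
  by (simp add: t_elem_def zof_def diag_tvar)

lemma inj_zof: "inj zof"
proof (rule injI)
  fix f g assume "zof f = zof g"
  then have "rel dvd diag f - diag g" by (simp add: zof_def cls_eq_iff)
  also have "diag f - diag g = diag (f - g)"
    using diag_add[of "f - g" g] by simp
  finally show "f = g" using diag_rel_dvd_imp by force
qed

lemma zof_eq_iff [simp]: "zof f = zof g \<longleftrightarrow> f = g"
  using inj_zof by (auto dest: injD)

text \<open>Every representative of an invariant class is invariant modulo \<open>rel\<close>, hence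
  congruent to a series in \<open>t\<close>; conversely such series are fixed by all rotations in
  \<open>G\<close>.\<close>

lemma Z_carrier: "carrier (Z_ring S n k) = range zof"
proof (intro equalityI subsetI)
  fix r assume "r \<in> carrier (Z_ring S n k)"
  then obtain s where s: "r = cls S n k s" and inv: "\<And>\<zeta>. \<zeta> ^ n = 1 \<Longrightarrow> rot S \<zeta> ` r = r"
    by (auto simp: Z_ring_def R_carrier)
  have "rel dvd rot S \<zeta> s - s" if "\<zeta> ^ n = 1" for \<zeta>
    using inv[OF that] that by (simp add: s rot_cls cls_eq_iff)
  then obtain f where "rel dvd s - diag f" using rot_invariant_cong_diag by blast
  then show "r \<in> range zof" by (auto simp: s zof_def cls_eq_iff)
next
  fix r assume "r \<in> range zof"
  then obtain f where r: "r = cls S n k (diag f)" by (auto simp: zof_def)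
  have "rot S \<zeta> ` r = r" if "\<zeta> ^ n = 1" for \<zeta>
    unfolding r rot_cls[OF that] rot_diag[OF root_nonzero[OF that]] ..
  moreover have "r \<in> carrier (R_ring S n k)" by (simp add: r R_carrier)
  ultimately show "r \<in> carrier (Z_ring S n k)" by (simp add: Z_ring_def)
qed

lemma zof_closed: "zof f \<in> carrier (Z_ring S n k)"
  by (simp add: Z_carrier)

lemma Z_nonzero: "nonzero (Z_ring S n k) = zof ` (- {0})"
  by (auto simp: nonzero_def Z_carrier Z_ops)

end

section \<open>Modules over \<open>A\<close>, with separate actions of the ring, the group and
  \<open>Z\<close>\<close>

locale xy_module = xy_coeffs S cf ct bdd n k + M?: left_module "A_ring S n k" M
  for S :: "'s::comm_ring_1 xy_ring" and cf and ct :: "'t::euclidean_ring \<Rightarrow> nat \<Rightarrow> complex"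
    and bdd and n k and M :: "(complex \<Rightarrow> 's set, 'm) module"
begin

definition sm :: "'s \<Rightarrow> 'm \<Rightarrow> 'm" where "sm s m = single 1 s \<odot>\<^bsub>M\<^esub> m"

definition ga :: "complex \<Rightarrow> 'm \<Rightarrow> 'm" where "ga \<zeta> m = single \<zeta> 1 \<odot>\<^bsub>M\<^esub> m"

definition tm :: "'t \<Rightarrow> 'm \<Rightarrow> 'm" where "tm f = sm (diag f)"

lemma sm_closed [simp]: "m \<in> carrier M \<Longrightarrow> sm s m \<in> carrier M"
  by (simp add: sm_def smult_closed elt_closed)

lemma ga_closed [simp]: "m \<in> carrier M \<Longrightarrow> ga \<zeta> m \<in> carrier M"
  by (simp add: ga_def smult_closed elt_closed)

lemma tm_closed [simp]: "m \<in> carrier M \<Longrightarrow> tm f m \<in> carrier M"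
  by (simp add: tm_def)

lemma zero_smult:
  assumes "m \<in> carrier M"
  shows "elt (\<lambda>_. 0) \<odot>\<^bsub>M\<^esub> m = \<zero>\<^bsub>M\<^esub>"
  using smult_l_distr[OF elt_closed elt_closed assms, of "\<lambda>_. 0" "\<lambda>_. 0"] assms
  by (simp add: A_add smult_closed elt_closed)

lemma smult_zero:
  assumes "a \<in> carrier (A_ring S n k)"
  shows "a \<odot>\<^bsub>M\<^esub> \<zero>\<^bsub>M\<^esub> = \<zero>\<^bsub>M\<^esub>"
  using smult_r_distr[OF assms, of "\<zero>\<^bsub>M\<^esub>" "\<zero>\<^bsub>M\<^esub>"] smult_closed[OF assms, of "\<zero>\<^bsub>M\<^esub>"] by simp

lemma sm_zero [simp]: "sm s \<zero>\<^bsub>M\<^esub> = \<zero>\<^bsub>M\<^esub>"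
  by (simp add: sm_def smult_zero elt_closed)

lemma ga_zero [simp]: "ga \<zeta> \<zero>\<^bsub>M\<^esub> = \<zero>\<^bsub>M\<^esub>"
  by (simp add: ga_def smult_zero elt_closed)

lemma sm_add_l: "m \<in> carrier M \<Longrightarrow> sm (s + s') m = sm s m \<oplus>\<^bsub>M\<^esub> sm s' m"
  unfolding sm_def
  by (subst smult_l_distr[symmetric]) (auto simp: elt_closed A_add intro!: arg_cong2[of _ _ _ _ "(\<odot>\<^bsub>M\<^esub>)"] elt_cong)

lemma sm_add_r: "m \<in> carrier M \<Longrightarrow> m' \<in> carrier M \<Longrightarrow> sm s (m \<oplus>\<^bsub>M\<^esub> m') = sm s m \<oplus>\<^bsub>M\<^esub> sm s m'"
  by (simp add: sm_def smult_r_distr elt_closed)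

lemma ga_add: "m \<in> carrier M \<Longrightarrow> m' \<in> carrier M \<Longrightarrow> ga \<zeta> (m \<oplus>\<^bsub>M\<^esub> m') = ga \<zeta> m \<oplus>\<^bsub>M\<^esub> ga \<zeta> m'"
  by (simp add: ga_def smult_r_distr elt_closed)

lemma sm_sm: "m \<in> carrier M \<Longrightarrow> sm s (sm s' m) = sm (s * s') m"
  unfolding sm_def
  by (subst smult_assoc1[symmetric]) (simp_all add: elt_closed A_single_mult_single rot_one_id rot_1 cong: if_cong)

lemma sm_one: "m \<in> carrier M \<Longrightarrow> sm 1 m = m"
  using smult_one[of m] by (simp add: sm_def A_one)

lemma sm_0 [simp]: "m \<in> carrier M \<Longrightarrow> sm 0 m = \<zero>\<^bsub>M\<^esub>"
  using zero_smult[of m] by (simp add: sm_def)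

lemma single_smult:
  assumes "m \<in> carrier M"
  shows "single \<zeta> s \<odot>\<^bsub>M\<^esub> m = sm s (ga \<zeta> m)"
  unfolding sm_def ga_def using assms
  by (subst smult_assoc1[symmetric]) (simp_all add: elt_closed A_single_mult_single rot_one_id rot_1 cong: if_cong)

lemma ga_sm:
  assumes "m \<in> carrier M" "\<zeta> ^ n = 1"
  shows "ga \<zeta> (sm s m) = sm (rot S \<zeta> s) (ga \<zeta> m)"
  unfolding sm_def ga_def using assms
  by (subst (1 2) smult_assoc1[symmetric]) (simp_all add: elt_closed A_single_mult_single rot_one_id rot_1 cong: if_cong)

lemma sm_cong: "rel dvd s - s' \<Longrightarrow> sm s m = sm s' m"
proof -
  assume "rel dvd s - s'"
  then have "single 1 s = single 1 s'"
    unfolding elt_def by (intro restrict_ext) (simp add: cls_eq_iff)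
  then show ?thesis by (simp add: sm_def)
qed

lemma tm_add_l: "m \<in> carrier M \<Longrightarrow> tm (f + g) m = tm f m \<oplus>\<^bsub>M\<^esub> tm g m"
  by (simp add: tm_def diag_add sm_add_l)

lemma tm_add_r: "m \<in> carrier M \<Longrightarrow> m' \<in> carrier M \<Longrightarrow> tm f (m \<oplus>\<^bsub>M\<^esub> m') = tm f m \<oplus>\<^bsub>M\<^esub> tm f m'"
  by (simp add: tm_def sm_add_r)

lemma tm_tm: "m \<in> carrier M \<Longrightarrow> tm f (tm g m) = tm (f * g) m"
  by (simp add: tm_def sm_sm diag_mult)

lemma tm_0 [simp]: "m \<in> carrier M \<Longrightarrow> tm 0 m = \<zero>\<^bsub>M\<^esub>"
  by (simp add: tm_def diag_0)

lemma tm_1: "m \<in> carrier M \<Longrightarrow> tm 1 m = m"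
  by (simp add: tm_def diag_1 sm_one)

lemma tm_zero [simp]: "tm f \<zero>\<^bsub>M\<^esub> = \<zero>\<^bsub>M\<^esub>"
  by (simp add: tm_def)

lemma tm_sm: "m \<in> carrier M \<Longrightarrow> tm f (sm s m) = sm s (tm f m)"
  by (simp add: tm_def sm_sm mult.commute)

lemma to_A_smult: "to_A S n k (cls S n k s) \<odot>\<^bsub>M\<^esub> m = sm s m"
  by (simp add: to_A_cls sm_def)

lemma to_A_zof_smult: "to_A S n k (zof f) \<odot>\<^bsub>M\<^esub> m = tm f m"
  by (simp add: zof_def tm_def to_A_smult)

lemma elt_smult_insert:
  assumes "m \<in> carrier M" "\<zeta> \<notin> F"
  shows "elt (\<lambda>h. if h \<in> insert \<zeta> F then p h else 0) \<odot>\<^bsub>M\<^esub> m =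
    sm (p \<zeta>) (ga \<zeta> m) \<oplus>\<^bsub>M\<^esub> elt (\<lambda>h. if h \<in> F then p h else 0) \<odot>\<^bsub>M\<^esub> m"
proof -
  have "elt (\<lambda>h. if h \<in> insert \<zeta> F then p h else 0) =
      single \<zeta> (p \<zeta>) \<oplus>\<^bsub>A_ring S n k\<^esub> elt (\<lambda>h. if h \<in> F then p h else 0)"
    unfolding A_add by (rule elt_cong) (use assms(2) in auto)
  then show ?thesis
    using assms by (simp add: smult_l_distr elt_closed single_smult)
qed

lemma elt_restrict_roots: "elt p = elt (\<lambda>h. if h \<in> {\<zeta>. \<zeta> ^ n = 1} then p h else 0)"
  by (rule elt_cong) simp

text \<open>Every element of \<open>A\<close> is a finite sum of products of a ring element and a
  group element, so induction over the support reduces the claim to the closure conditions.\<close>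

lemma smult_in_invariant_set:
  assumes "W \<subseteq> carrier M" "\<zero>\<^bsub>M\<^esub> \<in> W"
    and add: "\<And>u v. u \<in> W \<Longrightarrow> v \<in> W \<Longrightarrow> u \<oplus>\<^bsub>M\<^esub> v \<in> W"
    and sm: "\<And>s u. u \<in> W \<Longrightarrow> sm s u \<in> W"
    and ga: "\<And>\<zeta> u. \<zeta> ^ n = 1 \<Longrightarrow> u \<in> W \<Longrightarrow> ga \<zeta> u \<in> W"
    and a: "a \<in> carrier (A_ring S n k)" and w: "w \<in> W"
  shows "a \<odot>\<^bsub>M\<^esub> w \<in> W"
proof -
  have m: "w \<in> carrier M" using assms by blast
  have "elt (\<lambda>h. if h \<in> F then p h else 0) \<odot>\<^bsub>M\<^esub> w \<in> W"
    if "finite F" "F \<subseteq> {\<zeta>. \<zeta> ^ n = 1}" for p F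
    using that
  proof (induction F rule: finite_induct)
    case empty
    then show ?case using zero_smult[OF m] assms(2) by simp
  next
    case (insert \<zeta> F)
    then show ?case using m w by (subst elt_smult_insert) (auto intro!: add sm ga)
  qed
  from this[OF finite_roots subset_refl] show ?thesis
    using a elt_restrict_roots by (auto simp: A_carrier)
qed

section \<open>Weight spaces of the group\<close>

text \<open>This is the space \<open>e\<^sub>j M\<close>, as \<open>idem_image\<close> shows.
  Equations are handier than an image, and since only \<open>j\<close> modulo \<open>n\<close>
  matters, the index may run through all naturals.\<close>

definition E :: "nat \<Rightarrow> 'm set" where
  "E j = {m \<in> carrier M. \<forall>\<zeta>. \<zeta> ^ n = 1 \<longrightarrow> ga \<zeta> m = sm (scal S (\<zeta> ^ j)) m}"

lemma E_carrier: "v \<in> E j \<Longrightarrow> v \<in> carrier M"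
  by (simp add: E_def)

lemma ga_E: "v \<in> E j \<Longrightarrow> \<zeta> ^ n = 1 \<Longrightarrow> ga \<zeta> v = sm (scal S (\<zeta> ^ j)) v"
  by (simp add: E_def)

text \<open>The group acts on \<open>v\<close> through scalars, so every element of \<open>A\<close>
  moves the multiples of \<open>v\<close> inside \<open>R v\<close>, with an explicit
  coefficient.\<close>

lemma elt_smult_E:
  assumes v: "v \<in> E j"
  shows "elt p \<odot>\<^bsub>M\<^esub> sm r v = sm (\<Sum>\<zeta> | \<zeta> ^ n = 1. p \<zeta> * rot S \<zeta> r * scal S (\<zeta> ^ j)) v"
proof -
  have m: "v \<in> carrier M" using v E_carrier by blast
  have "elt (\<lambda>h. if h \<in> F then p h else 0) \<odot>\<^bsub>M\<^esub> sm r v =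
      sm (\<Sum>\<zeta>\<in>F. p \<zeta> * rot S \<zeta> r * scal S (\<zeta> ^ j)) v"
    if "finite F" "F \<subseteq> {\<zeta>. \<zeta> ^ n = 1}" for F
    using that
  proof (induction F rule: finite_induct)
    case empty
    then show ?case using zero_smult m by simp
  next
    case (insert \<zeta> F)
    then show ?case
      using m by (subst elt_smult_insert) (simp_all add: ga_sm ga_E[OF v] sm_sm sm_add_l mult.assoc)
  qed
  from this[OF finite_roots subset_refl] show ?thesis
    using elt_restrict_roots[of p] by simp
qed

text \<open>The factor \<open>\<zeta> ^ j\<close> by which \<open>\<zeta>\<close> acts on
  \<open>v\<close> cancels the one in the idempotent, and what remains is the Reynolds
  operator.\<close>

lemma idem_smult_E:
  assumes "v \<in> E j"
  shows "idem S n k j \<odot>\<^bsub>M\<^esub> sm r v = sm (avg r) v"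
proof -
  have "scal S (inverse \<zeta> ^ j / of_nat n) * rot S \<zeta> r * scal S (\<zeta> ^ j) = scal S (1 / of_nat n) * rot S \<zeta> r"
    if "\<zeta> ^ n = 1" for \<zeta>
  proof -
    have "scal S (inverse \<zeta> ^ j / of_nat n) * scal S (\<zeta> ^ j) = scal S (1 / of_nat n)"
      unfolding scal_mult[symmetric] using root_nonzero[OF that] by (simp add: power_inverse)
    then show ?thesis by (metis mult.commute mult.left_commute)
  qed
  then show ?thesis
    unfolding idem_elt elt_smult_E[OF assms] avg_def by (intro arg_cong2[of _ _ _ _ sm] sum.cong) auto
qed

lemma idem_fix:
  assumes "v \<in> E j"
  shows "idem S n k j \<odot>\<^bsub>M\<^esub> v = v"
proof -
  have "avg 1 = 1" by (rule cf_inject) (auto simp: cf_avg cf_one)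
  then show ?thesis
    using idem_smult_E[OF assms, of 1] E_carrier[OF assms] by (simp add: sm_one)
qed

lemma idem_in_E:
  assumes m: "m \<in> carrier M"
  shows "idem S n k j \<odot>\<^bsub>M\<^esub> m \<in> E j"
proof -
  have "ga \<zeta> (idem S n k j \<odot>\<^bsub>M\<^esub> m) = sm (scal S (\<zeta> ^ j)) (idem S n k j \<odot>\<^bsub>M\<^esub> m)"
    if z: "\<zeta> ^ n = 1" for \<zeta>
  proof -
    \<comment> \<open>Left multiplication by \<open>\<zeta>\<close> reindexes the sum that defines
      the idempotent and so scales it; this holds already in \<open>A\<close>.\<close>
    have "single \<zeta> 1 \<otimes>\<^bsub>A_ring S n k\<^esub> idem S n k j = single 1 (scal S (\<zeta> ^ j)) \<otimes>\<^bsub>A_ring S n k\<^esub> idem S n k j"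
      unfolding idem_elt A_single_mult[OF z] using A_single_mult[of 1]
      by (auto intro!: elt_cong simp: rot_scal power_mult_distrib field_simps simp flip: scal_mult)
    then show ?thesis
      unfolding ga_def sm_def using m
      by (metis smult_assoc1 elt_closed idem_elt)
  qed
  then show ?thesis using m by (simp add: E_def smult_closed idem_elt elt_closed)
qed

lemma idem_image: "(\<lambda>m. idem S n k j \<odot>\<^bsub>M\<^esub> m) ` carrier M = E j"
  using idem_in_E idem_fix E_carrier by (force simp: image_iff)

text \<open>The idempotents at the \<open>n\<close> vertices sum to \<open>1\<close>, so they cannot
  all annihilate \<open>m\<close>.\<close>

lemma E_nonzero_ex:
  assumes m: "m \<in> carrier M" "m \<noteq> \<zero>\<^bsub>M\<^esub>"
  obtains j v where "v \<in> E j" "v \<noteq> \<zero>\<^bsub>M\<^esub>"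
proof (rule ccontr)
  assume "\<not> thesis"
  then have z: "idem S n k j \<odot>\<^bsub>M\<^esub> m = \<zero>\<^bsub>M\<^esub>" for j
    using idem_in_E[OF m(1)] that by blast
  \<comment> \<open>The element is the partial sum of the first \<open>J\<close> idempotents; at
    \<open>J = n\<close> it becomes the identity of \<open>A\<close>.\<close>
  have P: "elt (\<lambda>\<zeta>. scal S (\<Sum>j<J. inverse \<zeta> ^ j / of_nat n)) \<odot>\<^bsub>M\<^esub> m = \<zero>\<^bsub>M\<^esub>" for J
  proof (induction J)
    case 0
    then show ?case using zero_smult m by (simp add: scal_0)
  next
    case (Suc J)
    have "elt (\<lambda>\<zeta>. scal S (\<Sum>j<Suc J. inverse \<zeta> ^ j / of_nat n)) =
        elt (\<lambda>\<zeta>. scal S (\<Sum>j<J. inverse \<zeta> ^ j / of_nat n)) \<oplus>\<^bsub>A_ring S n k\<^esub> idem S n k J"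
      by (simp add: A_add idem_elt scal_add)
    then show ?case
      using Suc z m by (simp add: smult_l_distr elt_closed idem_elt)
  qed
  have "elt (\<lambda>\<zeta>. scal S (\<Sum>j<n. inverse \<zeta> ^ j / of_nat n)) = single 1 1"
  proof (rule elt_cong)
    fix \<zeta> :: complex assume "\<zeta> ^ n = 1"
    then have "inverse \<zeta> ^ n = 1" by (simp add: power_inverse)
    from sum_root_of_unity_powers[OF this]
    show "scal S (\<Sum>j<n. inverse \<zeta> ^ j / of_nat n) = (if \<zeta> = 1 then 1 else 0)"
      using n_pos by (simp add: scal_1 scal_0 inverse_eq_1_iff flip: sum_divide_distrib)
  qed
  then show False using P[of n] m smult_one[of m] by (simp add: A_one)
qed

lemma E_zero [simp]: "\<zero>\<^bsub>M\<^esub> \<in> E j"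
  by (simp add: E_def)

lemma E_add: "u \<in> E j \<Longrightarrow> v \<in> E j \<Longrightarrow> u \<oplus>\<^bsub>M\<^esub> v \<in> E j"
  by (simp add: E_def ga_add sm_add_r)

lemma E_tm: "v \<in> E j \<Longrightarrow> tm f v \<in> E j"
  by (auto simp: E_def tm_def ga_sm rot_diag root_nonzero sm_sm mult.commute)

lemma E_n: "E n = E 0"
  by (simp add: E_def cong: conj_cong)

lemma x_E: "v \<in> E j \<Longrightarrow> sm (xvar S) v \<in> E (Suc j)"
  by (simp add: E_def ga_sm rot_xvar sm_sm mult.left_commute mult.commute flip: scal_mult)

lemma y_E: "v \<in> E (Suc j) \<Longrightarrow> sm (yvar S) v \<in> E j"
proof -
  assume v: "v \<in> E (Suc j)"
  have "ga \<zeta> (sm (yvar S) v) = sm (scal S (\<zeta> ^ j)) (sm (yvar S) v)" if "\<zeta> ^ n = 1" for \<zeta>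
  proof -
    have "scal S (inverse \<zeta>) * scal S (\<zeta> ^ Suc j) = scal S (\<zeta> ^ j)"
      unfolding scal_mult[symmetric] using root_nonzero[OF that] by (simp flip: mult.assoc)
    then have "scal S (inverse \<zeta>) * yvar S * scal S (\<zeta> ^ Suc j) = scal S (\<zeta> ^ j) * yvar S"
      by (metis mult.assoc mult.commute)
    then show ?thesis using v that E_carrier[OF v]
      by (simp add: ga_sm ga_E[OF v] rot_yvar sm_sm del: power_Suc)
  qed
  then show ?thesis using E_carrier[OF v] by (simp add: E_def)
qed

lemma xy_tm:
  assumes "v \<in> carrier M"
  shows "sm (xvar S) (sm (yvar S) v) = tm tvar v" "sm (yvar S) (sm (xvar S) v) = tm tvar v"
  using assms by (simp_all add: sm_sm tm_def diag_tvar mult.commute)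

text \<open>Trading \<open>x^k\<close> for \<open>y^(n-k)\<close> in
  \<open>x^n = x^k x^(n-k)\<close> leaves \<open>(x y)^(n-k)\<close>.\<close>

lemma x_power_n:
  assumes "v \<in> carrier M"
  shows "sm (xvar S ^ n) v = tm (tvar ^ (n - k)) v"
proof -
  have dp: "diag (tvar ^ p) = (xvar S * yvar S) ^ p" for p
    by (induction p) (simp_all add: diag_1 diag_mult diag_tvar)
  have "xvar S ^ n = xvar S ^ k * xvar S ^ (n - k)"
    using k_less by (simp flip: power_add)
  then have "xvar S ^ n - (xvar S * yvar S) ^ (n - k) = rel * xvar S ^ (n - k)"
    by (simp add: rel_def power_mult_distrib algebra_simps)
  then show ?thesis
    unfolding tm_def dp by (intro sm_cong) simp
qed

end

section \<open>Freeness and rank\<close>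

context xy_module
begin

section \<open>Coordinates and linear functionals\<close>

abbreviation N where "N \<equiv> restrict_scalars (to_A S n k) M"

lemma finsum_N:
  assumes "finite F" "g \<in> F \<rightarrow> carrier M"
  shows "finsum N g F = finsum M g F"
proof -
  have N: "abelian_monoid N"
    by (rule abelian_monoidI) (auto simp: restrict_scalars_def a_ac)
  show ?thesis
    using assms
  proof (induction F rule: finite_induct)
    case empty
    then show ?case by (simp add: abelian_monoid.finsum_empty[OF N]) (simp add: restrict_scalars_def)
  next
    case (insert a F)
    then show ?case
      by (subst abelian_monoid.finsum_insert[OF N]) (auto simp: restrict_scalars_def Pi_def)
  qed
qed

lemma tm_finsum:
  "finite F \<Longrightarrow> g \<in> F \<rightarrow> carrier M \<Longrightarrow> tm f (finsum M g F) = (\<Oplus>\<^bsub>M\<^esub>b\<in>F. tm f (g b))"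
  by (induction F rule: finite_induct) (auto simp: tm_add_r Pi_def)

text \<open>Extensional families with values in \<open>Z\<close> are exchanged for functions into
  \<open>'t\<close> that vanish outside \<open>B\<close>. These can be added and scaled
  pointwise.\<close>

lemma free_coordinates:
  assumes "free_module (Z_ring S n k) N"
  obtains B where "B \<subseteq> carrier M"
    "\<And>m. m \<in> carrier M \<Longrightarrow> \<exists>!c. (\<forall>b. b \<notin> B \<longrightarrow> c b = 0) \<and> finite {b. c b \<noteq> 0} \<and>
        m = (\<Oplus>\<^bsub>M\<^esub>b\<in>{b. c b \<noteq> 0}. tm (c b) b)"
proof -
  let ?Z = "Z_ring S n k"
  obtain B where B: "B \<subseteq> carrier M"
    and ex1: "\<And>m. m \<in> carrier M \<Longrightarrow> \<exists>!d. d \<in> B \<rightarrow>\<^sub>E carrier ?Z \<and> finite {b \<in> B. d b \<noteq> \<zero>\<^bsub>?Z\<^esub>} \<and>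
      m = (\<Oplus>\<^bsub>N\<^esub>b \<in> {b \<in> B. d b \<noteq> \<zero>\<^bsub>?Z\<^esub>}. d b \<odot>\<^bsub>N\<^esub> b)"
    using assms unfolding free_module_def by (auto simp: restrict_scalars_def)
  have supp: "{b \<in> B. (\<lambda>b\<in>B. zof (c b)) b \<noteq> \<zero>\<^bsub>?Z\<^esub>} = {b. c b \<noteq> 0}"
    if "\<forall>b. b \<notin> B \<longrightarrow> c b = 0" for c
    using that by (auto simp: Z_ops)
  have fs: "(\<Oplus>\<^bsub>N\<^esub>b \<in> {b. c b \<noteq> 0}. (\<lambda>b\<in>B. zof (c b)) b \<odot>\<^bsub>N\<^esub> b) = (\<Oplus>\<^bsub>M\<^esub>b\<in>{b. c b \<noteq> 0}. tm (c b) b)"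
    if c: "\<forall>b. b \<notin> B \<longrightarrow> c b = 0" and fin: "finite {b. c b \<noteq> 0}" for c
  proof -
    have eq: "(\<lambda>b\<in>B. zof (c b)) b \<odot>\<^bsub>N\<^esub> b = tm (c b) b" if "b \<in> {b. c b \<noteq> 0}" for b
    proof -
      have "b \<in> B" using that c by blast
      then show ?thesis by (simp add: restrict_scalars_def to_A_zof_smult)
    qed
    have closed: "tm (c b) b \<in> carrier M" if "b \<in> {b. c b \<noteq> 0}" for b
    proof -
      have "b \<in> carrier M" using that c B by blast
      then show ?thesis by simp
    qed
    have "(\<Oplus>\<^bsub>N\<^esub>b \<in> {b. c b \<noteq> 0}. (\<lambda>b\<in>B. zof (c b)) b \<odot>\<^bsub>N\<^esub> b) =
        (\<Oplus>\<^bsub>M\<^esub>b \<in> {b. c b \<noteq> 0}. (\<lambda>b\<in>B. zof (c b)) b \<odot>\<^bsub>N\<^esub> b)"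
      by (rule finsum_N[OF fin Pi_I]) (simp only: eq closed)
    also have "\<dots> = (\<Oplus>\<^bsub>M\<^esub>b\<in>{b. c b \<noteq> 0}. tm (c b) b)"
      by (rule finsum_cong'[OF refl Pi_I eq]) (rule closed)
    finally show ?thesis .
  qed
  have "\<exists>!c. (\<forall>b. b \<notin> B \<longrightarrow> c b = 0) \<and> finite {b. c b \<noteq> 0} \<and>
        m = (\<Oplus>\<^bsub>M\<^esub>b\<in>{b. c b \<noteq> 0}. tm (c b) b)" if m: "m \<in> carrier M" for m
  proof (rule ex_ex1I)
    obtain d where d: "d \<in> B \<rightarrow>\<^sub>E carrier ?Z" "finite {b \<in> B. d b \<noteq> \<zero>\<^bsub>?Z\<^esub>}"
      "m = (\<Oplus>\<^bsub>N\<^esub>b \<in> {b \<in> B. d b \<noteq> \<zero>\<^bsub>?Z\<^esub>}. d b \<odot>\<^bsub>N\<^esub> b)"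
      using ex1[OF m] by blast
    define c where "c b = (if b \<in> B then inv_into UNIV zof (d b) else 0)" for b
    have c: "\<forall>b. b \<notin> B \<longrightarrow> c b = 0" by (simp add: c_def)
    have "zof (c b) = d b" if "b \<in> B" for b
    proof -
      have "d b \<in> range zof" using d(1) that by (auto simp: Z_carrier)
      then show ?thesis using that by (simp add: c_def f_inv_into_f)
    qed
    then have dc: "d = (\<lambda>b\<in>B. zof (c b))" using d(1) by (intro extensionalityI[where A = B]) (auto simp: PiE_def)
    have fin: "finite {b. c b \<noteq> 0}" using d(2) unfolding dc supp[OF c] .
    have "m = (\<Oplus>\<^bsub>M\<^esub>b\<in>{b. c b \<noteq> 0}. tm (c b) b)"
      using d(3) unfolding dc supp[OF c] fs[OF c fin] .
    then show "\<exists>c. (\<forall>b. b \<notin> B \<longrightarrow> c b = 0) \<and> finite {b. c b \<noteq> 0} \<and>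
        m = (\<Oplus>\<^bsub>M\<^esub>b\<in>{b. c b \<noteq> 0}. tm (c b) b)"
      using c fin by blast
  next
    fix c c'
    assume c: "(\<forall>b. b \<notin> B \<longrightarrow> c b = 0) \<and> finite {b. c b \<noteq> 0} \<and> m = (\<Oplus>\<^bsub>M\<^esub>b\<in>{b. c b \<noteq> 0}. tm (c b) b)"
      and c': "(\<forall>b. b \<notin> B \<longrightarrow> c' b = 0) \<and> finite {b. c' b \<noteq> 0} \<and> m = (\<Oplus>\<^bsub>M\<^esub>b\<in>{b. c' b \<noteq> 0}. tm (c' b) b)"
    have spec: "(\<lambda>b\<in>B. zof (c b)) \<in> B \<rightarrow>\<^sub>E carrier ?Z \<and> finite {b \<in> B. (\<lambda>b\<in>B. zof (c b)) b \<noteq> \<zero>\<^bsub>?Z\<^esub>} \<and>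
      m = (\<Oplus>\<^bsub>N\<^esub>b \<in> {b \<in> B. (\<lambda>b\<in>B. zof (c b)) b \<noteq> \<zero>\<^bsub>?Z\<^esub>}. (\<lambda>b\<in>B. zof (c b)) b \<odot>\<^bsub>N\<^esub> b)"
      if "(\<forall>b. b \<notin> B \<longrightarrow> c b = 0) \<and> finite {b. c b \<noteq> 0} \<and> m = (\<Oplus>\<^bsub>M\<^esub>b\<in>{b. c b \<noteq> 0}. tm (c b) b)" for c
    proof -
      have h: "\<forall>b. b \<notin> B \<longrightarrow> c b = 0" "finite {b. c b \<noteq> 0}"
        "m = (\<Oplus>\<^bsub>M\<^esub>b\<in>{b. c b \<noteq> 0}. tm (c b) b)" using that by blast+
      have "(\<lambda>b\<in>B. zof (c b)) \<in> B \<rightarrow>\<^sub>E carrier ?Z" using zof_closed by auto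
      then show ?thesis unfolding supp[OF h(1)] fs[OF h(1,2)] using h(2,3) by blast
    qed
    have "(\<lambda>b\<in>B. zof (c b)) = (\<lambda>b\<in>B. zof (c' b))"
      using ex1[OF m] spec[OF c] spec[OF c'] by blast
    then have "c b = c' b" if "b \<in> B" for b
      using that by (auto dest: fun_cong[of _ _ b])
    then show "c = c'" using c c' by (intro ext) metis
  qed
  then show thesis using B that by blast
qed

text \<open>A coordinate function of the basis serves as \<open>l\<close>: some coordinate of
  \<open>m0\<close> is nonzero.\<close>

lemma free_functional:
  assumes free: "free_module (Z_ring S n k) N"
    and m0: "m0 \<in> carrier M" "m0 \<noteq> \<zero>\<^bsub>M\<^esub>"
  obtains l where "l m0 \<noteq> 0"
    "\<And>m m'. m \<in> carrier M \<Longrightarrow> m' \<in> carrier M \<Longrightarrow> l (m \<oplus>\<^bsub>M\<^esub> m') = l m + l m'"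
    "\<And>f m. m \<in> carrier M \<Longrightarrow> l (tm f m) = f * l m"
proof -
  obtain B where B: "B \<subseteq> carrier M"
    and ex1: "\<And>m. m \<in> carrier M \<Longrightarrow> \<exists>!c. (\<forall>b. b \<notin> B \<longrightarrow> c b = 0) \<and> finite {b. c b \<noteq> 0} \<and>
        m = (\<Oplus>\<^bsub>M\<^esub>b\<in>{b. c b \<noteq> 0}. tm (c b) b)"
    using free_coordinates[OF free] by blast
  define C where "C m = (THE c. (\<forall>b. b \<notin> B \<longrightarrow> c b = 0) \<and> finite {b. c b \<noteq> 0} \<and>
        m = (\<Oplus>\<^bsub>M\<^esub>b\<in>{b. c b \<noteq> 0}. tm (c b) b))" for m
  have C: "(\<forall>b. b \<notin> B \<longrightarrow> C m b = 0) \<and> finite {b. C m b \<noteq> 0} \<and>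
      m = (\<Oplus>\<^bsub>M\<^esub>b\<in>{b. C m b \<noteq> 0}. tm (C m b) b)" if "m \<in> carrier M" for m
    unfolding C_def by (rule theI'[OF ex1[OF that]])
  have neutral: "(\<Oplus>\<^bsub>M\<^esub>b\<in>{b. c b \<noteq> 0}. tm (c b) b) = (\<Oplus>\<^bsub>M\<^esub>b\<in>F. tm (c b) b)"
    if "finite F" "F \<subseteq> B" "{b. c b \<noteq> 0} \<subseteq> F" for c F
    by (rule add.finprod_mono_neutral_cong_left) (use that B in auto)
  \<comment> \<open>Coordinates may be read off from any finite part of the basis that contains the
    support, which gives two vectors a common index set.\<close>
  have C_unique: "C m = c"
    if "finite F" "F \<subseteq> B" "{b. c b \<noteq> 0} \<subseteq> F" "m = (\<Oplus>\<^bsub>M\<^esub>b\<in>F. tm (c b) b)" for m c F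
  proof -
    have m: "m \<in> carrier M" unfolding that(4) using that B by (intro finsum_closed) auto
    have "(\<forall>b. b \<notin> B \<longrightarrow> c b = 0) \<and> finite {b. c b \<noteq> 0} \<and> m = (\<Oplus>\<^bsub>M\<^esub>b\<in>{b. c b \<noteq> 0}. tm (c b) b)"
      using that neutral[OF that(1-3)] finite_subset[OF that(3,1)] by auto
    then show ?thesis using ex1[OF m] C[OF m] by blast
  qed
  have C_add: "C (m \<oplus>\<^bsub>M\<^esub> m') b = C m b + C m' b" if m: "m \<in> carrier M" "m' \<in> carrier M" for m m' b
  proof -
    define F where "F = {b. C m b \<noteq> 0} \<union> {b. C m' b \<noteq> 0}"
    have F: "finite F" "F \<subseteq> B" using C[OF m(1)] C[OF m(2)] by (auto simp: F_def)
    then have FM: "F \<subseteq> carrier M" using B by blast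
    have "m = (\<Oplus>\<^bsub>M\<^esub>b\<in>F. tm (C m b) b)" "m' = (\<Oplus>\<^bsub>M\<^esub>b\<in>F. tm (C m' b) b)"
      using C[OF m(1)] C[OF m(2)] neutral[OF F, of "C m"] neutral[OF F, of "C m'"]
      by (auto simp: F_def)
    then have "m \<oplus>\<^bsub>M\<^esub> m' = (\<Oplus>\<^bsub>M\<^esub>b\<in>F. tm (C m b) b) \<oplus>\<^bsub>M\<^esub> (\<Oplus>\<^bsub>M\<^esub>b\<in>F. tm (C m' b) b)" by metis
    also have "\<dots> = (\<Oplus>\<^bsub>M\<^esub>b\<in>F. tm (C m b) b \<oplus>\<^bsub>M\<^esub> tm (C m' b) b)"
      using FM by (subst finsum_addf) auto
    also have "\<dots> = (\<Oplus>\<^bsub>M\<^esub>b\<in>F. tm (C m b + C m' b) b)"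
      using FM by (intro finsum_cong') (auto simp: tm_add_l)
    finally have "C (m \<oplus>\<^bsub>M\<^esub> m') = (\<lambda>b. C m b + C m' b)"
      by (intro C_unique[OF F]) (auto simp: F_def)
    then show ?thesis by simp
  qed
  have C_tm: "C (tm f m) b = f * C m b" if m: "m \<in> carrier M" for f m b
  proof -
    define F where "F = {b. C m b \<noteq> 0}"
    have F: "finite F" "F \<subseteq> B" using C[OF m] by (auto simp: F_def)
    then have FM: "F \<subseteq> carrier M" using B by blast
    have "tm f m = tm f (\<Oplus>\<^bsub>M\<^esub>b\<in>F. tm (C m b) b)"
      using C[OF m] by (simp add: F_def)
    also have "\<dots> = (\<Oplus>\<^bsub>M\<^esub>b\<in>F. tm f (tm (C m b) b))"
      using FM by (intro tm_finsum F) auto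
    also have "\<dots> = (\<Oplus>\<^bsub>M\<^esub>b\<in>F. tm (f * C m b) b)"
      using FM by (intro finsum_cong') (auto simp: tm_tm)
    finally have "C (tm f m) = (\<lambda>b. f * C m b)"
      by (intro C_unique[OF F]) (auto simp: F_def)
    then show ?thesis by simp
  qed
  have "\<exists>b. C m0 b \<noteq> 0"
  proof (rule ccontr)
    assume "\<not> (\<exists>b. C m0 b \<noteq> 0)"
    then have "{b. C m0 b \<noteq> 0} = {}" by simp
    then show False using C[OF m0(1)] m0(2) by (metis finsum_empty)
  qed
  then obtain b where "C m0 b \<noteq> 0" by blast
  then show thesis by (rule that[of "\<lambda>m. C m b"]) (simp_all add: C_add C_tm)
qed

text \<open>A functional with \<open>l m \<noteq> 0\<close> turns the relation into
  \<open>f * l m = 0\<close> in a domain.\<close>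

lemma free_torsion_free:
  assumes free: "free_module (Z_ring S n k) N"
    and m: "m \<in> carrier M" and "tm f m = \<zero>\<^bsub>M\<^esub>" "f \<noteq> 0"
  shows "m = \<zero>\<^bsub>M\<^esub>"
proof (rule ccontr)
  assume "m \<noteq> \<zero>\<^bsub>M\<^esub>"
  then obtain l where l: "l m \<noteq> 0" "\<And>f m. m \<in> carrier M \<Longrightarrow> l (tm f m) = f * l m"
    using free_functional[OF free m] by metis
  have "l \<zero>\<^bsub>M\<^esub> = 0" using l(2)[OF zero_closed, of 0] by simp
  then show False using l(1) l(2)[OF m, of f] assms by simp
qed

section \<open>Saturated submodules and length\<close>

text \<open>The submodules \<open>W\<close> for which \<open>M / W\<close> has no
  \<open>Z\<close>-torsion. They can be recovered from their fractions, so strict chains of them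
  bound the length from below.\<close>

definition saturated :: "'m set \<Rightarrow> bool" where
  "saturated W \<longleftrightarrow> W \<subseteq> carrier M \<and> \<zero>\<^bsub>M\<^esub> \<in> W \<and> (\<forall>u\<in>W. \<forall>v\<in>W. u \<oplus>\<^bsub>M\<^esub> v \<in> W) \<and>
    (\<forall>u\<in>W. \<forall>s. sm s u \<in> W) \<and> (\<forall>u\<in>W. \<forall>\<zeta>. \<zeta> ^ n = 1 \<longrightarrow> ga \<zeta> u \<in> W) \<and>
    (\<forall>m\<in>carrier M. \<forall>f. f \<noteq> 0 \<longrightarrow> tm f m \<in> W \<longrightarrow> m \<in> W)"

lemma saturatedD:
  assumes "saturated W"
  shows "W \<subseteq> carrier M" "\<zero>\<^bsub>M\<^esub> \<in> W"
    "u \<in> W \<Longrightarrow> v \<in> W \<Longrightarrow> u \<oplus>\<^bsub>M\<^esub> v \<in> W" "u \<in> W \<Longrightarrow> sm s u \<in> W"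
    "\<zeta> ^ n = 1 \<Longrightarrow> u \<in> W \<Longrightarrow> ga \<zeta> u \<in> W"
  using assms by (simp_all add: saturated_def)

definition frac_of :: "'m set \<Rightarrow> ('m \<times> 's set) set set" where
  "frac_of W = {mfrac (Z_ring S n k) N m s | m s. m \<in> W \<and> s \<in> nonzero (Z_ring S n k)}"

lemma frac_ofI:
  "m \<in> W \<Longrightarrow> s \<in> nonzero (Z_ring S n k) \<Longrightarrow> mfrac (Z_ring S n k) N m s \<in> frac_of W"
  by (auto simp: frac_of_def)

lemma mfrac_eq:
  "mfrac (Z_ring S n k) N m (zof f) =
    {(m', s'). m' \<in> carrier M \<and> (\<exists>g. g \<noteq> 0 \<and> s' = zof g \<and>
      (\<exists>u. u \<noteq> 0 \<and> tm u (tm g m) = tm u (tm f m')))}"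
  unfolding mfrac_def Z_nonzero by (force simp: restrict_scalars_def to_A_zof_smult)

text \<open>If \<open>m / s\<close> equals a fraction with numerator in \<open>W\<close>, then a
  nonzero multiple of \<open>m\<close> lies in \<open>W\<close>, and saturation gives back
  \<open>m\<close>.\<close>

lemma mfrac_in_frac_of_iff:
  assumes W: "saturated W" and m: "m \<in> carrier M" and s: "s \<in> nonzero (Z_ring S n k)"
  shows "mfrac (Z_ring S n k) N m s \<in> frac_of W \<longleftrightarrow> m \<in> W"
proof
  assume "m \<in> W"
  then show "mfrac (Z_ring S n k) N m s \<in> frac_of W" using s by (auto simp: frac_of_def)
next
  assume "mfrac (Z_ring S n k) N m s \<in> frac_of W"
  then obtain m' s' where m': "m' \<in> W" "s' \<in> nonzero (Z_ring S n k)"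
    and eq: "mfrac (Z_ring S n k) N m s = mfrac (Z_ring S n k) N m' s'"
    by (auto simp: frac_of_def)
  obtain f f' where f: "f \<noteq> 0" "s = zof f" "f' \<noteq> 0" "s' = zof f'"
    using s m'(2) by (auto simp: Z_nonzero)
  have "(m, s) \<in> mfrac (Z_ring S n k) N m s"
    using f m by (auto simp: mfrac_eq intro!: exI[of _ 1])
  then obtain u where u: "u \<noteq> 0" "tm u (tm f m') = tm u (tm f' m)"
    unfolding eq unfolding f(2,4) mfrac_eq by auto
  have "tm u (tm f m') \<in> W" using m' W by (simp add: saturated_def tm_def)
  then have "tm (u * f') m \<in> W" using u m by (simp add: tm_tm)
  then show "m \<in> W" using W m u(1) f(3) unfolding saturated_def by (metis mult_eq_0_iff)
qed

lemma frac_submodule_frac_of: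
  assumes W: "saturated W"
  shows "frac_submodule (Z_ring S n k) (to_A S n k) (A_ring S n k) M (frac_of W)"
proof -
  have sub: "W \<subseteq> carrier M" and z: "\<zero>\<^bsub>M\<^esub> \<in> W" using saturatedD[OF W] by blast+
  have mult: "s \<otimes>\<^bsub>Z_ring S n k\<^esub> s' \<in> nonzero (Z_ring S n k)"
    if "s \<in> nonzero (Z_ring S n k)" "s' \<in> nonzero (Z_ring S n k)" for s s'
    using that by (auto simp: Z_nonzero Z_ops)
  have one: "\<one>\<^bsub>Z_ring S n k\<^esub> \<in> nonzero (Z_ring S n k)"
    by (auto simp: Z_nonzero Z_ops)
  have act: "a \<odot>\<^bsub>M\<^esub> m \<in> W" if "a \<in> carrier (A_ring S n k)" "m \<in> W" for a m
    by (rule smult_in_invariant_set[OF sub z _ _ _ that]) (fact saturatedD[OF W])+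
  have lin: "s' \<odot>\<^bsub>N\<^esub> m \<oplus>\<^bsub>M\<^esub> s \<odot>\<^bsub>N\<^esub> m' \<in> W"
    if h: "s \<in> nonzero (Z_ring S n k)" "s' \<in> nonzero (Z_ring S n k)" "m \<in> W" "m' \<in> W" for s s' m m'
  proof -
    obtain f f' where "s = zof f" "s' = zof f'" using h(1,2) by (auto simp: Z_nonzero)
    then have "s' \<odot>\<^bsub>N\<^esub> m = tm f' m" "s \<odot>\<^bsub>N\<^esub> m' = tm f m'"
      by (simp_all add: restrict_scalars_def to_A_zof_smult)
    then show ?thesis using h saturatedD[OF W] by (simp add: tm_def)
  qed
  show ?thesis
    unfolding frac_submodule_def Let_def
  proof (intro conjI ballI impI)
    show "frac_of W \<subseteq> fractions (Z_ring S n k) N"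
      using sub by (auto simp: frac_of_def fractions_def restrict_scalars_def)
    show "mfrac (Z_ring S n k) N \<zero>\<^bsub>M\<^esub> \<one>\<^bsub>Z_ring S n k\<^esub> \<in> frac_of W"
      using z one by (auto simp: frac_of_def)
  next
    fix m s m' s'
    assume "m \<in> carrier M" "s \<in> nonzero (Z_ring S n k)" "m' \<in> carrier M" "s' \<in> nonzero (Z_ring S n k)"
      "mfrac (Z_ring S n k) N m s \<in> frac_of W \<and> mfrac (Z_ring S n k) N m' s' \<in> frac_of W"
    then show "mfrac (Z_ring S n k) N (s' \<odot>\<^bsub>N\<^esub> m \<oplus>\<^bsub>M\<^esub> s \<odot>\<^bsub>N\<^esub> m') (s \<otimes>\<^bsub>Z_ring S n k\<^esub> s') \<in> frac_of W"
      using mfrac_in_frac_of_iff[OF W] by (intro frac_ofI lin mult) blast+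
  next
    fix a s m s'
    assume "a \<in> carrier (A_ring S n k)" "s \<in> nonzero (Z_ring S n k)" "m \<in> carrier M"
      "s' \<in> nonzero (Z_ring S n k)" "mfrac (Z_ring S n k) N m s' \<in> frac_of W"
    then show "mfrac (Z_ring S n k) N (a \<odot>\<^bsub>M\<^esub> m) (s \<otimes>\<^bsub>Z_ring S n k\<^esub> s') \<in> frac_of W"
      using mfrac_in_frac_of_iff[OF W] by (intro frac_ofI act mult) blast+
  qed
qed

text \<open>Over the zero module there is one fraction only, hence at most one submodule of
  fractions, and no chain has a proper step.\<close>

lemma rk_1_nontrivial:
  assumes "rk S n k M = 1"
  shows "\<exists>m\<in>carrier M. m \<noteq> \<zero>\<^bsub>M\<^esub>"
proof (rule ccontr)
  assume "\<not> ?thesis"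
  then have M0: "carrier M = {\<zero>\<^bsub>M\<^esub>}" by auto
  let ?U0 = "mfrac (Z_ring S n k) N \<zero>\<^bsub>M\<^esub> \<one>\<^bsub>Z_ring S n k\<^esub>"
  have "mfrac (Z_ring S n k) N m s = ?U0" if "m \<in> carrier M" "s \<in> nonzero (Z_ring S n k)" for m s
  proof -
    have zero: "mfrac (Z_ring S n k) N \<zero>\<^bsub>M\<^esub> (zof f) = {\<zero>\<^bsub>M\<^esub>} \<times> zof ` (- {0})" for f
    proof -
      have "\<exists>u::'t. u \<noteq> 0" by (rule exI[of _ 1]) simp
      then show ?thesis unfolding mfrac_eq M0 by auto
    qed
    obtain f where "s = zof f" using \<open>s \<in> _\<close> by (auto simp: Z_nonzero)
    then show ?thesis using \<open>m \<in> _\<close> zero unfolding M0 Z_ops by simp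
  qed
  then have "fractions (Z_ring S n k) N \<subseteq> {?U0}"
    by (auto simp: fractions_def restrict_scalars_def)
  then have single: "U = {?U0}" if "frac_submodule (Z_ring S n k) (to_A S n k) (A_ring S n k) M U" for U
    using that unfolding frac_submodule_def Let_def by blast
  have "l = 0" if "\<forall>i\<le>l. frac_submodule (Z_ring S n k) (to_A S n k) (A_ring S n k) M (U i)"
    "\<forall>i<l. U i \<subset> U (Suc i)" for l and U :: "nat \<Rightarrow> _"
  proof (rule ccontr)
    assume "l \<noteq> 0"
    then have "U 0 \<subset> U 1" "U 0 = {?U0}" "U 1 = {?U0}" using that by (auto intro!: single)
    then show False by simp
  qed
  then have "rk S n k M \<le> 0"
    unfolding rk_def frac_length_def by (intro SUP_least) (auto simp: zero_enat_def)
  then show False using assms by simp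
qed

text \<open>Otherwise the zero module, \<open>W\<close> and \<open>M\<close> would give a chain with
  two proper steps, against length one.\<close>

lemma rk_1_saturated:
  assumes free: "free_module (Z_ring S n k) N" and rk: "rk S n k M = 1"
    and W: "saturated W" and v: "v \<in> W" "v \<noteq> \<zero>\<^bsub>M\<^esub>"
  shows "W = carrier M"
proof (rule ccontr)
  assume ne: "W \<noteq> carrier M"
  have sub: "W \<subseteq> carrier M" using W by (simp add: saturated_def)
  have 0: "saturated {\<zero>\<^bsub>M\<^esub>}"
    using free_torsion_free[OF free] by (auto simp: saturated_def)
  have 2: "saturated (carrier M)" by (auto simp: saturated_def)
  have one: "\<one>\<^bsub>Z_ring S n k\<^esub> \<in> nonzero (Z_ring S n k)"
    by (auto simp: Z_nonzero Z_ops)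
  have strict: "frac_of W1 \<subset> frac_of W2"
    if W1: "saturated W1" and W2: "saturated W2" and less: "W1 \<subset> W2" for W1 W2
  proof -
    obtain m where m: "m \<in> W2" "m \<notin> W1" using less by blast
    then have "m \<in> carrier M" using saturatedD(1)[OF W2] by blast
    then have "mfrac (Z_ring S n k) N m \<one>\<^bsub>Z_ring S n k\<^esub> \<in> frac_of W2"
        "mfrac (Z_ring S n k) N m \<one>\<^bsub>Z_ring S n k\<^esub> \<notin> frac_of W1"
      using m mfrac_in_frac_of_iff[OF W1 _ one] mfrac_in_frac_of_iff[OF W2 _ one] by blast+
    moreover have "frac_of W1 \<subseteq> frac_of W2" using less unfolding frac_of_def by blast
    ultimately show ?thesis by blast
  qed
  define U where "U i = (if i = 0 then frac_of {\<zero>\<^bsub>M\<^esub>} else if i = 1 then frac_of W else frac_of (carrier M))"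
    for i :: nat
  have "\<forall>i\<le>2. frac_submodule (Z_ring S n k) (to_A S n k) (A_ring S n k) M (U i)"
    using frac_submodule_frac_of 0 W 2 by (auto simp: U_def)
  moreover have "U i \<subset> U (Suc i)" if "i < 2" for i
  proof -
    have "{\<zero>\<^bsub>M\<^esub>} \<subset> W" "W \<subset> carrier M" using v ne sub saturatedD(2)[OF W] by blast+
    then have "frac_of {\<zero>\<^bsub>M\<^esub>} \<subset> frac_of W" "frac_of W \<subset> frac_of (carrier M)"
      using strict[OF 0 W] strict[OF W 2] by blast+
    then show ?thesis using that by (cases i) (auto simp: U_def)
  qed
  ultimately have "enat 2 \<le> rk S n k M"
    unfolding rk_def frac_length_def by (intro SUP_upper) blast
  then show False using rk by (simp add: one_enat_def)
qed

end

section \<open>The weight spaces have rank at most one\<close>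

locale xy_rank_one = xy_module S cf ct bdd n k M
  for S :: "'s::comm_ring_1 xy_ring" and cf and ct :: "'t::euclidean_ring \<Rightarrow> nat \<Rightarrow> complex"
    and bdd and n k and M :: "(complex \<Rightarrow> 's set, 'm) module" +
  assumes free: "free_module (Z_ring S n k) (restrict_scalars (to_A S n k) M)"
    and rank: "rk S n k M = 1"
begin

lemma tm_eq_0: "m \<in> carrier M \<Longrightarrow> tm f m = \<zero>\<^bsub>M\<^esub> \<Longrightarrow> f \<noteq> 0 \<Longrightarrow> m = \<zero>\<^bsub>M\<^esub>"
  using free_torsion_free[OF free] by blast

lemma tm_cancel:
  assumes m: "m \<in> carrier M" "m \<noteq> \<zero>\<^bsub>M\<^esub>" and eq: "tm f m = tm g m"
  shows "f = g"
proof (rule ccontr)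
  assume "f \<noteq> g"
  have "tm (f - g) m \<oplus>\<^bsub>M\<^esub> tm g m = \<zero>\<^bsub>M\<^esub> \<oplus>\<^bsub>M\<^esub> tm g m"
    using m eq by (simp flip: tm_add_l)
  then have "tm (f - g) m = \<zero>\<^bsub>M\<^esub>" using m by (simp only: add.r_cancel tm_closed zero_closed)
  then show False using tm_eq_0[OF m(1), of "f - g"] \<open>f \<noteq> g\<close> m(2) by simp
qed

text \<open>The saturation of \<open>A v = R v\<close> is all of \<open>M\<close>.\<close>

lemma E_rank_le_1:
  assumes v: "v \<in> E j" "v \<noteq> \<zero>\<^bsub>M\<^esub>" and u: "u \<in> E j"
  obtains g f where "g \<noteq> 0" "tm g u = tm f v"
proof -
  have vM: "v \<in> carrier M" and uM: "u \<in> carrier M" using v u E_carrier by auto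
  \<comment> \<open>The elements with a nonzero \<open>Z\<close>-multiple in \<open>R v\<close>.
    Stability under the group holds because it acts on \<open>v\<close> by scalars.\<close>
  define W where "W = {w \<in> carrier M. \<exists>g r. g \<noteq> 0 \<and> tm g w = sm r v}"
  have "saturated W"
    unfolding saturated_def
  proof (intro conjI ballI allI impI)
    have "(1::'t) \<noteq> 0" "tm 1 \<zero>\<^bsub>M\<^esub> = sm 0 v" using vM by simp_all
    then show "\<zero>\<^bsub>M\<^esub> \<in> W" unfolding W_def by blast
  next
    fix w w' assume "w \<in> W" "w' \<in> W"
    then obtain g r g' r' where h: "w \<in> carrier M" "w' \<in> carrier M" "g \<noteq> 0" "g' \<noteq> 0"
      "tm g w = sm r v" "tm g' w' = sm r' v" by (auto simp: W_def)
    have "tm (g' * g) w = tm g' (sm r v)" "tm (g * g') w' = tm g (sm r' v)"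
      unfolding tm_tm[OF h(1), symmetric] tm_tm[OF h(2), symmetric] h(5,6) by (rule refl)+
    then have "tm (g * g') w = sm (diag g' * r) v" "tm (g * g') w' = sm (diag g * r') v"
      using sm_sm[OF vM] by (simp_all add: tm_def mult.commute)
    then have "tm (g * g') (w \<oplus>\<^bsub>M\<^esub> w') = sm (diag g' * r + diag g * r') v"
      using h vM by (simp add: tm_add_r sm_add_l)
    moreover have "g * g' \<noteq> 0" using h by simp
    ultimately show "w \<oplus>\<^bsub>M\<^esub> w' \<in> W" using h unfolding W_def by blast
  next
    fix w s assume "w \<in> W"
    then obtain g r where h: "w \<in> carrier M" "g \<noteq> 0" "tm g w = sm r v" by (auto simp: W_def)
    then have "tm g (sm s w) = sm (s * r) v" using vM by (simp add: tm_sm sm_sm)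
    then show "sm s w \<in> W" using h unfolding W_def by auto
  next
    fix w and \<zeta> :: complex assume "w \<in> W" and z: "\<zeta> ^ n = 1"
    then obtain g r where h: "w \<in> carrier M" "g \<noteq> 0" "tm g w = sm r v" by (auto simp: W_def)
    have "tm g (ga \<zeta> w) = ga \<zeta> (tm g w)"
      unfolding tm_def ga_sm[OF h(1) z] rot_diag[OF root_nonzero[OF z]] by (rule refl)
    then have "tm g (ga \<zeta> w) = sm (rot S \<zeta> r * scal S (\<zeta> ^ j)) v"
      using h vM z by (simp add: ga_sm ga_E[OF v(1)] sm_sm)
    then show "ga \<zeta> w \<in> W" using h unfolding W_def by auto
  next
    fix w f assume w: "w \<in> carrier M" "f \<noteq> 0" "tm f w \<in> W"
    then obtain g r where "g \<noteq> 0" "tm (g * f) w = sm r v" by (auto simp: W_def tm_tm)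
    moreover from this w have "g * f \<noteq> 0" by simp
    ultimately show "w \<in> W" using w unfolding W_def by blast
  qed (auto simp: W_def)
  moreover have "v \<in> W"
  proof -
    have "(1::'t) \<noteq> 0" "tm 1 v = sm 1 v" using vM by (simp_all add: tm_1 sm_one)
    then show ?thesis using vM unfolding W_def by blast
  qed
  ultimately have "W = carrier M" using rk_1_saturated[OF free rank] v(2) by blast
  then obtain g r where g: "g \<noteq> 0" "tm g u = sm r v" using uM unfolding W_def by blast
  \<comment> \<open>Applying the idempotent fixes the left side and averages \<open>r\<close>, which
    is then congruent to a series in \<open>t\<close>.\<close>
  have "tm g u = idem S n k j \<odot>\<^bsub>M\<^esub> sm r v"
    using idem_fix[OF E_tm[OF u]] g by metis
  also have "\<dots> = sm (avg r) v" by (rule idem_smult_E[OF v(1)])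
  finally have 1: "tm g u = sm (avg r) v" .
  obtain f where "rel dvd avg r - diag f" by (rule avg_cong_diag)
  then have "tm g u = tm f v" using 1 by (simp add: tm_def sm_cong)
  then show thesis using that g(1) by blast
qed

section \<open>Generators of the weight spaces\<close>

definition gen :: "nat \<Rightarrow> 'm \<Rightarrow> bool" where
  "gen j v \<longleftrightarrow> v \<in> E j \<and> v \<noteq> \<zero>\<^bsub>M\<^esub> \<and> (\<forall>u\<in>E j. \<exists>f. u = tm f v)"

text \<open>Rank one makes \<open>l\<close> injective on \<open>E j\<close>. A vector whose value
  under \<open>l\<close> has least Euclidean size among the nonzero ones then generates, by division
  with remainder.\<close>

lemma gen_ex:
  assumes v: "v \<in> E j" "v \<noteq> \<zero>\<^bsub>M\<^esub>"
  shows "\<exists>w. gen j w"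
proof -
  have vM: "v \<in> carrier M" using v E_carrier by blast
  obtain l where l: "l v \<noteq> 0"
    and l_add: "\<And>m m'. m \<in> carrier M \<Longrightarrow> m' \<in> carrier M \<Longrightarrow> l (m \<oplus>\<^bsub>M\<^esub> m') = l m + l m'"
    and l_tm: "\<And>f m. m \<in> carrier M \<Longrightarrow> l (tm f m) = f * l m"
    using free_functional[OF free vM v(2)] by metis
  have l0: "l \<zero>\<^bsub>M\<^esub> = 0" using l_tm[OF zero_closed, of 0] by simp
  have inj: "u = \<zero>\<^bsub>M\<^esub>" if u: "u \<in> E j" "l u = 0" for u
  proof -
    have uM: "u \<in> carrier M" using u E_carrier by blast
    obtain g f where g: "g \<noteq> 0" "tm g u = tm f v" using E_rank_le_1[OF v u(1)] by blast
    then have "f * l v = g * l u" using l_tm vM uM by metis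
    then have "f = 0" using u l by simp
    then have "tm g u = \<zero>\<^bsub>M\<^esub>" using g vM by simp
    then show ?thesis using tm_eq_0 uM g(1) by blast
  qed
  define w where "w = arg_min (\<lambda>u. euclidean_size (l u)) (\<lambda>u. u \<in> E j \<and> l u \<noteq> 0)"
  have w: "w \<in> E j" "l w \<noteq> 0"
    and min: "\<And>u. u \<in> E j \<Longrightarrow> l u \<noteq> 0 \<Longrightarrow> euclidean_size (l w) \<le> euclidean_size (l u)"
    using arg_min_nat_lemma[of "\<lambda>u. u \<in> E j \<and> l u \<noteq> 0" v "\<lambda>u. euclidean_size (l u)"] v(1) l
    by (auto simp: w_def)
  have wM: "w \<in> carrier M" using w E_carrier by blast
  have "u = tm (l u div l w) w" if u: "u \<in> E j" for u
  proof -
    have uM: "u \<in> carrier M" using u E_carrier by blast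
    define q where "q = l u div l w"
    \<comment> \<open>The remainder of the division, lifted to the module.\<close>
    define r where "r = u \<oplus>\<^bsub>M\<^esub> tm (- q) w"
    have rE: "r \<in> E j" using u w by (simp add: r_def E_add E_tm)
    have lr: "l r = l u mod l w"
      using uM wM by (simp add: r_def l_add l_tm q_def minus_div_mult_eq_mod)
    have "l r = 0"
    proof (rule ccontr)
      assume "l r \<noteq> 0"
      then have "euclidean_size (l w) \<le> euclidean_size (l r)" using min rE by blast
      moreover have "euclidean_size (l r) < euclidean_size (l w)"
        unfolding lr by (rule mod_size_less[OF w(2)])
      ultimately show False by simp
    qed
    then have "r = \<zero>\<^bsub>M\<^esub>" using inj rE by blast
    then have "u \<oplus>\<^bsub>M\<^esub> (tm (- q) w \<oplus>\<^bsub>M\<^esub> tm q w) = tm q w"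
      using uM wM by (simp add: r_def flip: a_assoc)
    then show ?thesis using uM wM by (simp add: q_def flip: tm_add_l)
  qed
  then have "gen j w" using w l0 unfolding gen_def by metis
  then show ?thesis by blast
qed

lemma xvar_eq_0: "v \<in> carrier M \<Longrightarrow> sm (xvar S) v = \<zero>\<^bsub>M\<^esub> \<Longrightarrow> v = \<zero>\<^bsub>M\<^esub>"
  using xy_tm(2)[of v] tm_eq_0[of v tvar] tvar_neq_0 by auto

text \<open>A nonzero weight vector exists at some vertex, and the injective map \<open>x\<close>
  carries it on to vertex \<open>0\<close>.\<close>

lemma gen_0_ex: "\<exists>w. gen 0 w"
proof -
  obtain m where "m \<in> carrier M" "m \<noteq> \<zero>\<^bsub>M\<^esub>" using rk_1_nontrivial[OF rank] by blast
  then obtain j v where v: "v \<in> E j" "v \<noteq> \<zero>\<^bsub>M\<^esub>" using E_nonzero_ex by blast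
  have step: "\<exists>w. w \<in> E (j + i) \<and> w \<noteq> \<zero>\<^bsub>M\<^esub>" for i
  proof (induction i)
    case 0
    then show ?case using v by auto
  next
    case (Suc i)
    then show ?case using x_E xvar_eq_0 E_carrier by (metis add_Suc_right)
  qed
  \<comment> \<open>\<open>n * j\<close> is a multiple of \<open>n\<close> not below
    \<open>j\<close>, so \<open>n * j - j\<close> applications of \<open>x\<close> end at weight
    \<open>0\<close>.\<close>
  have "E (j + (n * j - j)) = E 0"
  proof -
    have "j \<le> n * j" using n_pos by simp
    moreover have "\<zeta> ^ (n * j) = 1" if "\<zeta> ^ n = 1" for \<zeta> :: complex
      using that by (simp add: power_mult)
    ultimately show ?thesis by (simp add: E_def cong: conj_cong)
  qed
  then show ?thesis using step[of "n * j - j"] gen_ex by metis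
qed

lemma gen_unit:
  assumes g: "gen j w" and u: "f * u = 1"
  shows "gen j (tm f w)"
proof -
  have w: "w \<in> E j" "w \<noteq> \<zero>\<^bsub>M\<^esub>" and wM: "w \<in> carrier M" using g E_carrier by (auto simp: gen_def)
  have wu: "tm u (tm f w) = w" using wM u by (simp add: tm_tm tm_1 mult.commute)
  have "\<exists>h. v = tm h (tm f w)" if vE: "v \<in> E j" for v
  proof -
    obtain h where "v = tm h w" using g vE by (auto simp: gen_def)
    then have "v = tm (h * u) (tm f w)" using wu wM by (simp flip: tm_tm)
    then show ?thesis by blast
  qed
  moreover have "tm f w \<noteq> \<zero>\<^bsub>M\<^esub>" using wu w by auto
  ultimately show ?thesis using w by (simp add: gen_def E_tm)
qed

text \<open>The coefficients \<open>a\<close> of \<open>x\<close> and \<open>b\<close> of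
  \<open>y\<close> between two generators satisfy \<open>a * b = tvar\<close>. One of them is a
  unit, and rescaling \<open>w\<close> absorbs it.\<close>

lemma gen_step:
  assumes g: "gen j v"
  obtains w where "gen (Suc j) w"
    "sm (xvar S) v = w \<and> sm (yvar S) w = tm tvar v \<or>
     sm (xvar S) v = tm tvar w \<and> sm (yvar S) w = v"
proof -
  have v: "v \<in> E j" "v \<noteq> \<zero>\<^bsub>M\<^esub>" and vM: "v \<in> carrier M" using g E_carrier by (auto simp: gen_def)
  have "sm (xvar S) v \<noteq> \<zero>\<^bsub>M\<^esub>" using xvar_eq_0 v vM by blast
  then obtain w where w: "gen (Suc j) w" using gen_ex x_E v by blast
  have wM: "w \<in> carrier M" using w E_carrier by (auto simp: gen_def)
  obtain a where a: "sm (xvar S) v = tm a w" using w x_E[OF v(1)] by (auto simp: gen_def)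
  obtain b where b: "sm (yvar S) w = tm b v" using g y_E[of w j] w by (auto simp: gen_def)
  have "tm (a * b) v = tm tvar v"
    using xy_tm(2)[OF vM] wM vM by (simp add: a b tm_tm flip: tm_sm)
  then have ab: "a * b = tvar" using tm_cancel[OF vM v(2)] by blast
  from tvar_eq_mult[OF ab] show thesis
  proof
    assume "\<exists>u. a * u = 1"
    then have "gen (Suc j) (tm a w)" using gen_unit[OF w] by blast
    moreover have "sm (yvar S) (tm a w) = tm tvar v"
      using wM vM by (simp add: b tm_tm ab flip: tm_sm)
    ultimately show thesis using that a by blast
  next
    assume "\<exists>u. b * u = 1"
    then obtain u where u: "b * u = 1" by blast
    then have "gen (Suc j) (tm u w)" using gen_unit[OF w, of u b] by (simp add: mult.commute)
    moreover have y: "sm (yvar S) (tm u w) = v"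
      using wM vM u by (simp add: b tm_tm tm_1 mult.commute flip: tm_sm)
    moreover have "sm (xvar S) v = tm tvar (tm u w)"
      using xy_tm(1)[of "tm u w"] wM y by simp
    ultimately show thesis using that by blast
  qed
qed

text \<open>Each generator is adjusted to the preceding one, over all naturals; \<open>v n\<close>
  and \<open>v 0\<close> generate the same space but are compared only when the circuit is
  closed.\<close>

lemma gen_sequence:
  obtains v where "\<And>j. gen j (v j)"
    "\<And>j. sm (xvar S) (v j) = v (Suc j) \<and> sm (yvar S) (v (Suc j)) = tm tvar (v j) \<or>
      sm (xvar S) (v j) = tm tvar (v (Suc j)) \<and> sm (yvar S) (v (Suc j)) = v j"
proof -
  have "\<exists>v. \<forall>j. gen j (v j) \<and>
    (sm (xvar S) (v j) = v (Suc j) \<and> sm (yvar S) (v (Suc j)) = tm tvar (v j) \<or>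
      sm (xvar S) (v j) = tm tvar (v (Suc j)) \<and> sm (yvar S) (v (Suc j)) = v j)"
    by (rule dependent_nat_choice) (use gen_0_ex gen_step in metis)+
  then show thesis using that by blast
qed

end

section \<open>Isomorphisms with \<open>L\<^sub>I\<close>\<close>

context xy_rank_one
begin

section \<open>The representation of \<open>M\<close> and the uniqueness of \<open>I\<close>\<close>

lemma E_mod: "a \<in> {1..n} \<Longrightarrow> E (a mod n) = E a"
  using E_n by (cases "a = n") auto

lemma module_rep_simps:
  "carrier (space (module_rep S n k M) j) = E j"
  "u \<oplus>\<^bsub>space (module_rep S n k M) j\<^esub> v = u \<oplus>\<^bsub>M\<^esub> v"
  "zof f \<odot>\<^bsub>space (module_rep S n k M) j\<^esub> v = tm f v"
  "xmap (module_rep S n k M) a v = sm (xvar S) v"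
  "ymap (module_rep S n k M) a v = sm (yvar S) v"
  by (simp_all add: module_rep_def idem_image restrict_scalars_def to_A_zof_smult to_A_smult)

lemma L_rep_simps:
  "carrier (space (L_rep S n k I) j) = range zof"
  "zof f \<oplus>\<^bsub>space (L_rep S n k I) j\<^esub> zof g = zof (f + g)"
  "zof f \<odot>\<^bsub>space (L_rep S n k I) j\<^esub> zof g = zof (f * g)"
  "xmap (L_rep S n k I) a (zof f) = zof ((if a \<in> I then 1 else tvar) * f)"
  "ymap (L_rep S n k I) a (zof f) = zof ((if a \<in> I then tvar else 1) * f)"
  by (simp_all add: L_rep_def regular_module_def Z_carrier Z_ops t_elem_zof)

text \<open>On \<open>L\<^sub>I\<close> the map \<open>x\<close> at \<open>a\<close> is
  multiplication by \<open>1\<close> or by the nonunit \<open>t\<close>. The right side refers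
  neither to \<open>I\<close> nor to the isomorphism, which is why it determines
  \<open>I\<close>.\<close>

lemma x_surj_iff:
  assumes iso: "iso_to_L S n k M I" and a: "a \<in> {1..n}"
  shows "a \<in> I \<longleftrightarrow> E (a mod n) \<subseteq> sm (xvar S) ` E (a - 1)"
proof -
  obtain \<phi> where \<phi>:
      "\<And>j. j < n \<Longrightarrow> bij_betw (\<phi> j) (E j) (range zof)"
      "\<And>v. v \<in> E (a - 1) \<Longrightarrow> \<phi> (a mod n) (sm (xvar S) v) = xmap (L_rep S n k I) a (\<phi> (a - 1) v)"
    using iso a unfolding iso_to_L_def rep_iso_def module_rep_simps L_rep_simps
    by (elim exE conjE) metis
  have lt: "a mod n < n" "a - 1 < n" using a by auto
  note b1 = \<phi>(1)[OF lt(1)] and b2 = \<phi>(1)[OF lt(2)]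
  have xE: "sm (xvar S) v \<in> E (a mod n)" if "v \<in> E (a - 1)" for v
    using x_E[OF that] a E_mod[OF a] by simp
  show ?thesis
  proof
    assume I: "a \<in> I"
    show "E (a mod n) \<subseteq> sm (xvar S) ` E (a - 1)"
    proof
      fix w assume w: "w \<in> E (a mod n)"
      then obtain f where f: "\<phi> (a mod n) w = zof f" using bij_betwE[OF b1] by blast
      obtain v where v: "v \<in> E (a - 1)" "\<phi> (a - 1) v = zof f"
        using bij_betw_imp_surj_on[OF b2] by (metis imageE rangeI)
      have "\<phi> (a mod n) (sm (xvar S) v) = \<phi> (a mod n) w"
        unfolding \<phi>(2)[OF v(1)] v(2) L_rep_simps f using I by simp
      then have "sm (xvar S) v = w"
        using inj_onD[OF bij_betw_imp_inj_on[OF b1]] xE[OF v(1)] w by blast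
      then show "w \<in> sm (xvar S) ` E (a - 1)" using v by blast
    qed
  next
    assume surj: "E (a mod n) \<subseteq> sm (xvar S) ` E (a - 1)"
    show "a \<in> I"
    proof (rule ccontr)
      assume I: "a \<notin> I"
      \<comment> \<open>\<open>w\<close> corresponds to \<open>1\<close>, which is no multiple of
        \<open>t\<close>.\<close>
      obtain w where w: "w \<in> E (a mod n)" "\<phi> (a mod n) w = zof 1"
        using bij_betw_imp_surj_on[OF b1] by (metis imageE rangeI)
      then obtain v where v: "v \<in> E (a - 1)" "w = sm (xvar S) v" using surj by blast
      obtain f where f: "\<phi> (a - 1) v = zof f" using bij_betwE[OF b2] v(1) by blast
      have "zof 1 = zof (tvar * f)"
        using \<phi>(2)[OF v(1)] I unfolding w(2)[unfolded v(2)] f L_rep_simps by simp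
      then show False using tvar_not_unit by (metis zof_eq_iff)
    qed
  qed
qed

lemma iso_to_L_unique:
  assumes "iso_to_L S n k M I" "iso_to_L S n k M J" "I \<subseteq> {1..n}" "J \<subseteq> {1..n}"
  shows "I = J"
  using x_surj_iff[OF assms(1)] x_surj_iff[OF assms(2)] assms(3,4) by blast

section \<open>Existence of \<open>I\<close>\<close>

text \<open>The isomorphism takes the coefficient with respect to \<open>v j\<close> at each vertex;
  \<open>v n = v 0\<close> makes it compatible with the arrows that close the cycle.\<close>

lemma iso_to_L_if_generators:
  assumes g: "\<And>j. gen j (v j)" and vn: "v n = v 0"
    and in_I: "\<And>a. a \<in> I \<Longrightarrow> a \<in> {1..n} \<Longrightarrow>
      sm (xvar S) (v (a - 1)) = v a \<and> sm (yvar S) (v a) = tm tvar (v (a - 1))"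
    and notin_I: "\<And>a. a \<notin> I \<Longrightarrow> a \<in> {1..n} \<Longrightarrow>
      sm (xvar S) (v (a - 1)) = tm tvar (v a) \<and> sm (yvar S) (v a) = v (a - 1)"
  shows "iso_to_L S n k M I"
proof -
  have vM: "v j \<in> carrier M" for j using g E_carrier by (auto simp: gen_def)
  have vmod: "v (a mod n) = v a" if "a \<in> {1..n}" for a
    using that vn by (cases "a = n") auto
  \<comment> \<open>On \<open>E j\<close> the coefficient is unique by \<open>tm_cancel\<close>, so
    the description denotes it.\<close>
  define \<phi> where "\<phi> j u = zof (THE f. u = tm f (v j))" for j u
  have \<phi>: "\<phi> j (tm f (v j)) = zof f" for j f
  proof -
    have "(THE f'. tm f (v j) = tm f' (v j)) = f"
      using tm_cancel[OF vM] g by (intro the_equality) (auto simp: gen_def)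
    then show ?thesis by (simp add: \<phi>_def)
  qed
  have E_ex: "\<exists>f. u = tm f (v j)" if "u \<in> E j" for u j
    using g that by (auto simp: gen_def)
  have v_E: "tm f (v j) \<in> E j" for f j using g E_tm by (auto simp: gen_def)
  have bij: "bij_betw (\<phi> j) (E j) (range zof)" for j
  proof (rule bij_betw_imageI)
    show "inj_on (\<phi> j) (E j)"
    proof (rule inj_onI)
      fix u w assume uw: "u \<in> E j" "w \<in> E j" "\<phi> j u = \<phi> j w"
      obtain f h where "u = tm f (v j)" "w = tm h (v j)" using E_ex uw by metis
      then show "u = w" using uw(3) by (simp add: \<phi>)
    qed
    show "\<phi> j ` E j = range zof"
    proof (intro equalityI subsetI)
      fix z assume "z \<in> range zof"
      then obtain f where "z = zof f" by blast
      then have "z = \<phi> j (tm f (v j))" by (simp add: \<phi>)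
      then show "z \<in> \<phi> j ` E j" using v_E by blast
    qed (auto simp: \<phi>_def)
  qed
  have add: "\<phi> j (u \<oplus>\<^bsub>M\<^esub> w) = \<phi> j u \<oplus>\<^bsub>space (L_rep S n k I) j\<^esub> \<phi> j w"
    if uw: "u \<in> E j" "w \<in> E j" for j u w
  proof -
    obtain f h where "u = tm f (v j)" "w = tm h (v j)" using E_ex uw by metis
    then show ?thesis using vM by (simp add: \<phi> L_rep_simps flip: tm_add_l)
  qed
  have smult: "\<phi> j (z \<odot>\<^bsub>space (module_rep S n k M) j\<^esub> u) = z \<odot>\<^bsub>space (L_rep S n k I) j\<^esub> \<phi> j u"
    if z: "z \<in> range zof" and u: "u \<in> E j" for j z u
  proof -
    obtain f h where "u = tm f (v j)" "z = zof h" using E_ex[OF u] z by blast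
    then show ?thesis using vM by (simp add: \<phi> L_rep_simps module_rep_simps tm_tm)
  qed
  have x: "\<phi> (a mod n) (sm (xvar S) u) = xmap (L_rep S n k I) a (\<phi> (a - 1) u)"
    if a: "a \<in> {1..n}" and u: "u \<in> E (a - 1)" for a u
  proof -
    obtain f where f: "u = tm f (v (a - 1))" using E_ex[OF u] by blast
    have "sm (xvar S) u = tm ((if a \<in> I then 1 else tvar) * f) (v a)"
      using in_I[OF _ a] notin_I[OF _ a] vM by (simp add: f tm_tm mult.commute flip: tm_sm)
    then show ?thesis by (simp only: f \<phi> L_rep_simps flip: vmod[OF a])
  qed
  have y: "\<phi> (a - 1) (sm (yvar S) u) = ymap (L_rep S n k I) a (\<phi> (a mod n) u)"
    if a: "a \<in> {1..n}" and u: "u \<in> E (a mod n)" for a u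
  proof -
    obtain f where f: "u = tm f (v (a mod n))" using E_ex[OF u] by blast
    have "sm (yvar S) u = tm ((if a \<in> I then tvar else 1) * f) (v (a - 1))"
      using in_I[OF _ a] notin_I[OF _ a] vM by (simp add: f vmod[OF a] tm_tm mult.commute flip: tm_sm)
    then show ?thesis by (simp only: f \<phi> L_rep_simps)
  qed
  show ?thesis
    unfolding iso_to_L_def rep_iso_def Z_carrier module_rep_simps(1,2,4,5) L_rep_simps(1)
    by (intro exI[of _ \<phi>] conjI allI impI ballI bij add smult x y)
qed

lemma iso_to_L_ex:
  obtains I where "I \<subseteq> {1..n}" "card I = k" "iso_to_L S n k M I"
proof -
  obtain v where g: "\<And>j. gen j (v j)"
    and v: "\<And>j. sm (xvar S) (v j) = v (Suc j) \<and> sm (yvar S) (v (Suc j)) = tm tvar (v j) \<or>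
      sm (xvar S) (v j) = tm tvar (v (Suc j)) \<and> sm (yvar S) (v (Suc j)) = v j"
    using gen_sequence by blast
  have vM: "v j \<in> carrier M" and v0: "v j \<noteq> \<zero>\<^bsub>M\<^esub>" for j using g E_carrier by (auto simp: gen_def)
  define P where "P a \<longleftrightarrow> sm (xvar S) (v (a - 1)) = v a \<and> sm (yvar S) (v a) = tm tvar (v (a - 1))" for a
  have notP: "sm (xvar S) (v (a - 1)) = tm tvar (v a) \<and> sm (yvar S) (v a) = v (a - 1)"
    if "\<not> P a" "a \<in> {1..n}" for a
    using v[of "a - 1"] that by (auto simp: P_def)
  define I where "I = {a \<in> {1..n}. P a}"
  \<comment> \<open>\<open>c m\<close> counts the arrows up to \<open>m\<close> at which
    \<open>x\<close> contributes a factor \<open>t\<close>.\<close>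
  define c where "c m = card {a \<in> {1..m}. \<not> P a}" for m
  have c_Suc: "c (Suc m) = (if P (Suc m) then c m else Suc (c m))" for m
  proof -
    have "{a \<in> {1..Suc m}. \<not> P a} =
        (if P (Suc m) then {a \<in> {1..m}. \<not> P a} else insert (Suc m) {a \<in> {1..m}. \<not> P a})"
      by (auto simp: le_Suc_eq)
    then show ?thesis by (simp add: c_def)
  qed
  have xm: "sm (xvar S ^ m) (v 0) = tm (tvar ^ c m) (v m)" if "m \<le> n" for m
    using that
  proof (induction m)
    case 0
    then show ?case using vM by (simp add: c_def sm_one tm_1)
  next
    case (Suc m)
    have "sm (xvar S ^ Suc m) (v 0) = sm (xvar S) (tm (tvar ^ c m) (v m))"
      using Suc vM by (simp flip: sm_sm)
    also have "\<dots> = tm (tvar ^ c m) (sm (xvar S) (v m))"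
      using vM by (simp add: tm_sm)
    also have "\<dots> = tm (tvar ^ c (Suc m)) (v (Suc m))"
      using notP[of "Suc m"] Suc.prems vM
      by (auto simp: c_Suc P_def tm_tm mult.commute)
    finally show ?case .
  qed
  \<comment> \<open>\<open>E n\<close> and \<open>E 0\<close> coincide, so the two generators differ
    by a unit \<open>u\<close>.\<close>
  obtain u where u: "v n = tm u (v 0)" using g[of 0] g[of n] E_n by (auto simp: gen_def)
  obtain u' where u': "v 0 = tm u' (v n)" using g[of 0] g[of n] E_n by (auto simp: gen_def)
  have "tm (u' * u) (v 0) = tm 1 (v 0)"
    using u u' vM by (simp add: tm_1 flip: tm_tm)
  then have unit: "u * u' = 1" using tm_cancel vM v0 by (metis mult.commute)
  \<comment> \<open>Once around the quiver, the product of the steps is compared with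
    \<open>x^n = t^(n-k)\<close>. This gives both the count of factors and
    \<open>u = 1\<close>.\<close>
  have "tm (tvar ^ c n * u) (v 0) = tm (tvar ^ (n - k)) (v 0)"
    using xm[of n] x_power_n[OF vM, of 0] u vM by (simp add: tm_tm)
  then have "tvar ^ c n * u = tvar ^ (n - k)" using tm_cancel vM v0 by blast
  then have cn: "c n = n - k" and "u = 1" using tvar_power_unit_eq[OF _ unit] by blast+
  then have vn: "v n = v 0" using u vM by (simp add: tm_1)
  have "{a \<in> {1..n}. \<not> P a} = {1..n} - I" by (auto simp: I_def)
  moreover have IS: "I \<subseteq> {1..n}" by (auto simp: I_def)
  ultimately have "c n = n - card I"
    using card_Diff_subset[OF finite_subset[OF IS] IS] unfolding c_def by simp
  moreover have "card I \<le> n"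
    using card_mono[OF _ IS] by simp
  ultimately have "card I = k" using cn k_less by simp
  moreover have "iso_to_L S n k M I"
    by (rule iso_to_L_if_generators[OF g vn]) (use notP in \<open>auto simp: I_def P_def\<close>)
  ultimately show thesis using that IS by blast
qed

end

lemma (in xy_coeffs) rank_one_CM:
  fixes M :: "(complex \<Rightarrow> 's set, 'm) module"
  assumes "CM S n k M" "rk S n k M = 1"
  shows "\<exists>!I. I \<subseteq> {1..n} \<and> card I = k \<and> iso_to_L S n k M I"
proof -
  interpret left_module "A_ring S n k" M using assms(1) by (simp add: CM_def)
  interpret xy_rank_one S cf ct bdd n k M
    by unfold_locales (use assms in \<open>simp_all add: CM_def\<close>)
  show ?thesis
    using iso_to_L_ex iso_to_L_unique by metis
qed

section \<open>The polynomial ring and the power series ring as instances\<close>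

lemma poly_coeffs_ex:
  fixes e :: "nat \<Rightarrow> 'a::comm_monoid_add"
  assumes "\<forall>a. e a \<noteq> 0 \<longrightarrow> a \<le> D"
  shows "\<exists>p. \<forall>a. coeff p a = e a"
proof -
  have "coeff (\<Sum>i\<le>D. monom (e i) i) a = (\<Sum>i\<le>D. if i = a then e a else 0)" for a
    unfolding coeff_sum by (intro sum.cong) auto
  then show ?thesis using assms by (intro exI[of _ "\<Sum>i\<le>D. monom (e i) i"]) auto
qed

lemma coeff_rot_xy_poly: "coeff (coeff (rot xy_poly \<zeta> s) a) b = \<zeta> ^ a * inverse \<zeta> ^ b * coeff (coeff s a) b"
proof -
  have "[:\<zeta>:] ^ a * q = smult (\<zeta> ^ a) q" for q by (simp add: poly_const_pow)
  then show ?thesis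
    by (simp add: xy_poly_def coeff_pcompose_linear coeff_map_poly)
qed

lemma coeff_0_1: "coeff [:0, 1:] a = (if a = 1 then 1 else 0)"
  by (simp add: coeff_pCons split: nat.split)

lemma xy_coeffs_poly:
  assumes "0 < k" "k < n"
  shows "xy_coeffs xy_poly (\<lambda>s a b. coeff (coeff s a) b) coeff True n k"
proof
  fix s :: "complex poly poly"
  show "\<exists>D. \<forall>a b. coeff (coeff s a) b \<noteq> 0 \<longrightarrow> a \<le> D \<and> b \<le> D"
  proof -
    \<comment> \<open>One bound for both exponents: the outer degree plus all the inner
      degrees.\<close>
    define D where "D = degree s + (\<Sum>a\<le>degree s. degree (coeff s a))"
    have "a \<le> D \<and> b \<le> D" if "coeff (coeff s a) b \<noteq> 0" for a b
    proof -
      have a: "a \<le> degree s" using that by (intro le_degree) auto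
      have "b \<le> degree (coeff s a)" using that by (rule le_degree)
      also have "\<dots> \<le> (\<Sum>a\<le>degree s. degree (coeff s a))"
        using a by (intro member_le_sum) auto
      finally show ?thesis using a by (simp add: D_def)
    qed
    then show ?thesis by blast
  qed
next
  fix e :: "nat \<Rightarrow> nat \<Rightarrow> complex"
  assume "True \<Longrightarrow> \<exists>D. \<forall>a b. e a b \<noteq> 0 \<longrightarrow> a \<le> D \<and> b \<le> D"
  then obtain D where D: "\<And>a b. e a b \<noteq> 0 \<Longrightarrow> a \<le> D \<and> b \<le> D" by blast
  have "\<exists>p. \<forall>b. coeff p b = e a b" for a
    by (rule poly_coeffs_ex) (use D in blast)
  then obtain p where p: "\<And>a b. coeff (p a) b = e a b" by metis
  have "\<exists>s. \<forall>a. coeff s a = p a"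
  proof (rule poly_coeffs_ex)
    show "\<forall>a. p a \<noteq> 0 \<longrightarrow> a \<le> D" using D p by (metis poly_eqI coeff_0)
  qed
  then show "\<exists>s. \<forall>a b. coeff (coeff s a) b = e a b" using p by metis
next
  fix d :: "nat \<Rightarrow> complex"
  assume "True \<Longrightarrow> \<exists>D. \<forall>a. d a \<noteq> 0 \<longrightarrow> a \<le> D"
  then show "\<exists>f. \<forall>a. coeff f a = d a" using poly_coeffs_ex by blast
next
  fix f :: "complex poly"
  show "\<exists>D. \<forall>a. coeff f a \<noteq> 0 \<longrightarrow> a \<le> D" using le_degree by blast
qed (use assms in \<open>auto simp: coeff_rot_xy_poly poly_eq_iff coeff_mult coeff_sum\<close>,
  simp_all add: xy_poly_def coeff_0_1 coeff_pCons split: nat.split)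

lemma xy_coeffs_fps:
  assumes "0 < k" "k < n"
  shows "xy_coeffs xy_fps (\<lambda>s a b. fps_nth (fps_nth s a) b) fps_nth False n k"
proof
  fix e :: "nat \<Rightarrow> nat \<Rightarrow> complex"
  show "\<exists>s. \<forall>a b. fps_nth (fps_nth s a) b = e a b"
    by (rule exI[of _ "Abs_fps (\<lambda>a. Abs_fps (e a))"]) simp
next
  fix d :: "nat \<Rightarrow> complex"
  show "\<exists>f. \<forall>a. fps_nth f a = d a"
    by (rule exI[of _ "Abs_fps d"]) simp
qed (use assms in \<open>auto simp: fps_eq_iff fps_mult_nth fps_sum_nth xy_fps_def atMost_atLeast0\<close>)

theorem proposition5p2:
  fixes n k :: nat
  assumes "2 \<le> n" and "1 \<le> k" and "k \<le> n - 1"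
  shows "(\<forall>M :: (complex \<Rightarrow> complex poly poly set, 'm) module.
            CM xy_poly n k M \<and> rk xy_poly n k M = 1 \<longrightarrow>
            (\<exists>!I. I \<subseteq> {1..n} \<and> card I = k \<and> iso_to_L xy_poly n k M I))
       \<and> (\<forall>M :: (complex \<Rightarrow> complex fps fps set, 'm) module.
            CM xy_fps n k M \<and> rk xy_fps n k M = 1 \<longrightarrow>
            (\<exists>!I. I \<subseteq> {1..n} \<and> card I = k \<and> iso_to_L xy_fps n k M I))"
proof -
  have kn: "0 < k" "k < n" using assms by auto
  show ?thesis
    by (intro conjI allI impI; elim conjE)
      (rule xy_coeffs.rank_one_CM[OF xy_coeffs_poly[OF kn]] xy_coeffs.rank_one_CM[OF xy_coeffs_fps[OF kn]],
        assumption+)+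
qed

end
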